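(* Let $\rho\ge0$. The universal $\mathsf{IcOrdCMon}$-entropy of $(\mathsf{LProb}_\rho,-/\mathsf{LProb}_\rho)$ is: (a) if $\rho=0$, $(h_0,h_1):-/\mathsf{LProb}_\rho\Rightarrow\Delta_{(H_0,H_1)(\mathsf{FinProb})}$, mapping $X:P\to Q$ to $(H_0(Q),H_1(Q))$; (b) if $0<\rho<1$, $h_1:-/\mathsf{LProb}_\rho\Rightarrow\Delta_{\mathbb{R}_{\ge0}}$, mapping $X:P\to Q$ to $H_1(Q)$; (c) if $\rho\ge1$, the constant $z:-/\mathsf{LProb}_\rho\Rightarrow\Delta_{\{0\}}$. Equivalently, the universal baseless $\mathsf{IcOrdCMon}$-entropy is: $(H_0,H_1):\mathsf{LProb}_\rho\to(H_0,H_1)(\mathsf{FinProb})$ if $\rho=0$; $H_1:\mathsf{LProb}_\rho\to\mathbb{R}_{\ge0}$ if $0<\rho<1$; and the constant map $\mathsf{LProb}_\rho\to\{0\}$ if $\rho\ge1$.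
   Context: **LProb.** For $\rho\ge0$, $\mathsf{LProb}_\rho$ has as objects strictly positive probability mass functions $P$ on finite or countable sets $S$ with $\sum_{x\in S}P(x)^\rho<\infty$; morphisms $P\to Q$ are measure-preserving maps $f$, i.e. $Q(y)=\sum_{x\in f^{-1}(y)}P(x)$. (For $\rho=0$ this is $\mathsf{FinProb}$, the category of strictly positive probability mass functions on finite sets.) The tensor product is the product distribution; the unit $I$ is the one-point distribution. The under category $P/\mathsf{LProb}_\rho$ has objects $X:P\to A$ ("random variables") and morphisms $X\to X'$ given by $f:A\to A'$ with $fX=X'$; its tensor product $X\otimes_PY$ is the joint random variable $x\mapsto(X(x),Y(x))$ with codomain the pushforward of $P$ on the image of $(X,Y)$, and its unit $I_P$ is $P\to I$. $H_1(P)=-\sum_xP(x)\log P(x)$, $H_0(P)=\log|\mathrm{supp}(P)|$. $(H_0,H_1)(\mathsf{FinProb})=\{(H_0(P),H_1(P)):P\in\mathsf{FinProb}\}\subseteq\mathbb{R}^2$ with addition and product order. $\mathbb{R}_{\ge0}$ has addition and the usual order. **Ordered monoids.** $\mathsf{OrdCMon}$: partially ordered commutative monoids (with $x\ge y,z\ge w\Rightarrow x+z\ge y+w$) and order-preserving monoid homomorphisms. Such a monoid is integrally closed if whenever $nx+a\ge ny+b$ for all integers $n\ge1$ (for some fixed $a,b$) one has $x\ge y$. $\mathsf{IcOrdCMon}$ is the full subcategory of integrally closed ones. $W\in\mathsf{OrdCMon}$ is viewed as a monoidal category with a morphism $a\to b$ iff $a\ge b$. **Entropies.** Write $\mathsf{C}=\mathsf{LProb}_\rho$.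 For $\mathsf{V}\subseteq\mathsf{OrdCMon}$, a $\mathsf{V}$-entropy of $(\mathsf{C},-/\mathsf{C})$ is a monoidal natural transformation $h:-/\mathsf{C}\Rightarrow\Delta_W$ with $W\in\mathsf{V}$, between lax monoidal functors from $\mathsf{C}^{\mathrm{op}}$ to monoidal categories with lax monoidal functors ($-/\mathsf{C}$ acts on morphisms by precomposition and has coherence map $(X,Y)\mapsto X\otimes Y$; $\Delta_W$ is constant with coherence maps $+$ and $0$). Unpacked: functions $h_P:\mathrm{Ob}(P/\mathsf{C})\to W$, $P\in\mathsf{C}$, such that (1) $h_P(X)\ge h_P(X')$ if there is a morphism $X\to X'$ in $P/\mathsf{C}$; (2) $h_P(X)+h_P(Y)\ge h_P(X\otimes_PY)$ and $0\ge h_P(I_P)$; (3) $h_P(X\circ f)=h_Q(X)$ for $f:P\to Q$, $X\in Q/\mathsf{C}$; (4) $h_{P\otimes Q}(X\otimes Y)=h_P(X)+h_Q(Y)$ for $X\in P/\mathsf{C}$, $Y\in Q/\mathsf{C}$, and $h_I(I_I)=0$. It is universal if for every $\mathsf{V}$-entropy $h'$ into $W'\in\mathsf{V}$ there is a unique morphism $t:W\to W'$ in $\mathsf{V}$ with $h'_P=t\circ h_P$ for all $P$. The baseless entropy corresponding to $h$ is $H(P)=h_P(\mathrm{id}_P)$ (so $h_P(X)=H(A)$ for $X:P\to A$); a baseless $\mathsf{V}$-entropy $H$ into $W$ is universal if every baseless $\mathsf{V}$-entropy $H'$ into $W'\in\mathsf{V}$ is $H'=t\circ H$ for a unique $t:W\to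 W'$ in $\mathsf{V}$. *)

theory Defs
  imports
    "HOL-Probability.Probability"
    "HOL-Algebra.Group"
    "HOL-Library.Infinite_Typeclass"
    "HOL-Library.Nat_Bijection"
    "HOL-Library.Product_Order"
begin

section \<open>Finite and countable probability spaces\<close>

text \<open>
  All finite and countable sets are taken as subsets of one arbitrary infinite type of points that
  is closed under ordered pairs. As the type is infinite, every finite or countable set has a
  copy in it. A strictly positive probability mass function on a finite or countable set \<open>S\<close> of
  points is a \<open>pmf\<close> whose support \<open>set_pmf\<close> is \<open>S\<close>.
\<close>

class points = infinite +
  fixes point :: 'a
    and pt_pair :: "'a \<Rightarrow> 'a \<Rightarrow> 'a"
  assumes inj_pt_pair: "inj (\<lambda>(x, y). pt_pair x y)"

instantiation nat :: points
begin
definition "point = (0 :: nat)"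
definition "pt_pair x y = prod_encode (x, y)" for x y :: nat
instance
  by standard (auto simp: pt_pair_nat_def inj_def)
end

definition pt_unpair :: "'u::points \<Rightarrow> 'u \<times> 'u" where
  "pt_unpair = inv_into UNIV (\<lambda>(x, y). pt_pair x y)"

lemma pt_unpair_pair [simp]: "pt_unpair (pt_pair x y) = (x, y)"
  unfolding pt_unpair_def using inv_f_f[OF inj_pt_pair, of "(x, y)"] by simp

text \<open>\<open>pmf P x > 0\<close> on the support, so the junk value \<open>0 powr \<rho> = 0\<close> never occurs in the sum.\<close>

definition LProb :: "real \<Rightarrow> 'u pmf set" where
  "LProb \<rho> = {P. (\<lambda>x. pmf P x powr \<rho>) summable_on set_pmf P}"

definition FinProb :: "'u pmf set" where
  "FinProb = {P. finite (set_pmf P)}"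

lemma LProb_0: "LProb 0 = FinProb"
proof -
  have "(\<lambda>x. pmf P x powr 0) summable_on set_pmf P \<longleftrightarrow> finite (set_pmf P)" for P :: "'u pmf"
  proof -
    have "(\<lambda>x. pmf P x powr 0) summable_on set_pmf P \<longleftrightarrow> (\<lambda>x. 1::real) summable_on set_pmf P"
      by (rule summable_on_cong) (simp add: set_pmf_iff)
    then show ?thesis
      using infsum_diverge_constant[of "set_pmf P" "1::real"] by auto
  qed
  then show ?thesis
    unfolding LProb_def FinProb_def by blast
qed

text \<open>
  Maps are extensional, that is \<open>undefined\<close> outside their domain, so that HOL equality is
  equality of morphisms.
\<close>

definition LProb_hom :: "real \<Rightarrow> 'u pmf \<Rightarrow> 'u pmf \<Rightarrow> ('u \<Rightarrow> 'u) set" where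
  "LProb_hom \<rho> P Q =
    {f \<in> set_pmf P \<rightarrow>\<^sub>E set_pmf Q. P \<in> LProb \<rho> \<and> Q \<in> LProb \<rho> \<and> map_pmf f P = Q}"

definition LProb_id :: "'u pmf \<Rightarrow> 'u \<Rightarrow> 'u" where
  "LProb_id P = (\<lambda>x\<in>set_pmf P. x)"

definition LProb_unit :: "'u::points pmf" where
  "LProb_unit = return_pmf point"

definition LProb_tensor :: "'u::points pmf \<Rightarrow> 'u pmf \<Rightarrow> 'u pmf" where
  "LProb_tensor P Q = map_pmf (\<lambda>(x, y). pt_pair x y) (pair_pmf P Q)"

definition tensor_map :: "'u::points pmf \<Rightarrow> 'u pmf \<Rightarrow> ('u \<Rightarrow> 'u) \<Rightarrow> ('u \<Rightarrow> 'u) \<Rightarrow> 'u \<Rightarrow> 'u" where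
  "tensor_map P Q X Y =
    (\<lambda>z\<in>set_pmf (LProb_tensor P Q). case pt_unpair z of (x, y) \<Rightarrow> pt_pair (X x) (Y y))"


section \<open>Random variables: the under category of a probability space\<close>

text \<open>
  A random variable on \<open>P\<close> is given by its map \<open>X\<close> alone: its codomain is necessarily the
  pushforward \<open>map_pmf X P\<close>.
\<close>

definition under_obj :: "real \<Rightarrow> 'u pmf \<Rightarrow> ('u \<Rightarrow> 'u) set" where
  "under_obj \<rho> P = {X. \<exists>A. X \<in> LProb_hom \<rho> P A}"

definition cod :: "'u pmf \<Rightarrow> ('u \<Rightarrow> 'u) \<Rightarrow> 'u pmf" where
  "cod P X = map_pmf X P"

definition under_hom :: "real \<Rightarrow> 'u pmf \<Rightarrow> ('u \<Rightarrow> 'u) \<Rightarrow> ('u \<Rightarrow> 'u) \<Rightarrow> ('u \<Rightarrow> 'u) set" where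
  "under_hom \<rho> P X X' = {f \<in> LProb_hom \<rho> (cod P X) (cod P X'). compose (set_pmf P) f X = X'}"

definition under_tensor :: "'u::points pmf \<Rightarrow> ('u \<Rightarrow> 'u) \<Rightarrow> ('u \<Rightarrow> 'u) \<Rightarrow> 'u \<Rightarrow> 'u" where
  "under_tensor P X Y = (\<lambda>x\<in>set_pmf P. pt_pair (X x) (Y x))"

definition under_unit :: "'u::points pmf \<Rightarrow> 'u \<Rightarrow> 'u" where
  "under_unit P = (\<lambda>x\<in>set_pmf P. point)"


section \<open>Partially ordered commutative monoids\<close>

text \<open>The operation is the multiplication of the monoid record, so that \<open>n x\<close> becomes \<open>x [^] n\<close>.\<close>

record 'w ord_monoid = "'w monoid" +
  geq :: "'w \<Rightarrow> 'w \<Rightarrow> bool" (infixl \<open>\<succeq>\<index>\<close> 50)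

locale ord_comm_monoid = comm_monoid W for W (structure) +
  assumes geq_refl: "reflp_on (carrier W) (geq W)"
    and geq_antisym: "antisymp_on (carrier W) (geq W)"
    and geq_trans: "transp_on (carrier W) (geq W)"
    and geq_mult: "\<lbrakk>x \<in> carrier W; y \<in> carrier W; z \<in> carrier W; w \<in> carrier W; x \<succeq> y; z \<succeq> w\<rbrakk>
      \<Longrightarrow> x \<otimes> z \<succeq> y \<otimes> w"

definition integrally_closed :: "'w ord_monoid \<Rightarrow> bool" where
  "integrally_closed W \<longleftrightarrow>
    (\<forall>x\<in>carrier W. \<forall>y\<in>carrier W. \<forall>a\<in>carrier W. \<forall>b\<in>carrier W.
      (\<forall>n::nat. n \<ge> 1 \<longrightarrow> (x [^]\<^bsub>W\<^esub> n) \<otimes>\<^bsub>W\<^esub> a \<succeq>\<^bsub>W\<^esub> (y [^]\<^bsub>W\<^esub> n) \<otimes>\<^bsub>W\<^esub> b) \<longrightarrow> x \<succeq>\<^bsub>W\<^esub> y)"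

definition OrdCMon :: "'w ord_monoid set" where
  "OrdCMon = {W. ord_comm_monoid W}"

definition IcOrdCMon :: "'w ord_monoid set" where
  "IcOrdCMon = {W \<in> OrdCMon. integrally_closed W}"

definition OrdCMon_hom :: "'w ord_monoid \<Rightarrow> 'v ord_monoid \<Rightarrow> ('w \<Rightarrow> 'v) set" where
  "OrdCMon_hom W W' =
    {t \<in> carrier W \<rightarrow>\<^sub>E carrier W'.
      t \<in> hom W W' \<and> t \<one>\<^bsub>W\<^esub> = \<one>\<^bsub>W'\<^esub> \<and>
      (\<forall>x\<in>carrier W. \<forall>y\<in>carrier W. x \<succeq>\<^bsub>W\<^esub> y \<longrightarrow> t x \<succeq>\<^bsub>W'\<^esub> t y)}"

definition additive_ord_monoid :: "'w::{plus, zero, ord} set \<Rightarrow> 'w ord_monoid" where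
  "additive_ord_monoid S = \<lparr>carrier = S, mult = (+), one = 0, geq = (\<ge>)\<rparr>"


section \<open>Entropies\<close>

text \<open>
  This is the explicit form of a monoidal natural transformation from the under category functor
  to the constant functor at \<open>W\<close>. The values \<open>h P X\<close> matter only for \<open>P\<close> in \<open>LProb \<rho>\<close> and
  \<open>X\<close> an object of the under category of \<open>P\<close>.
\<close>

definition entropy_into ::
  "real \<Rightarrow> 'w ord_monoid \<Rightarrow> ('u::points pmf \<Rightarrow> ('u \<Rightarrow> 'u) \<Rightarrow> 'w) \<Rightarrow> bool" where
  "entropy_into \<rho> W h \<longleftrightarrow>
    (\<forall>P\<in>LProb \<rho>. \<forall>X\<in>under_obj \<rho> P. h P X \<in> carrier W) \<and>
    (\<forall>P\<in>LProb \<rho>. \<forall>X\<in>under_obj \<rho> P. \<forall>X'\<in>under_obj \<rho> P.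
      under_hom \<rho> P X X' \<noteq> {} \<longrightarrow> h P X \<succeq>\<^bsub>W\<^esub> h P X') \<and>
    (\<forall>P\<in>LProb \<rho>. \<forall>X\<in>under_obj \<rho> P. \<forall>Y\<in>under_obj \<rho> P.
      h P X \<otimes>\<^bsub>W\<^esub> h P Y \<succeq>\<^bsub>W\<^esub> h P (under_tensor P X Y)) \<and>
    (\<forall>P\<in>LProb \<rho>. \<one>\<^bsub>W\<^esub> \<succeq>\<^bsub>W\<^esub> h P (under_unit P)) \<and>
    (\<forall>P\<in>LProb \<rho>. \<forall>Q\<in>LProb \<rho>. \<forall>f\<in>LProb_hom \<rho> P Q. \<forall>X\<in>under_obj \<rho> Q.
      h P (compose (set_pmf P) X f) = h Q X) \<and>
    (\<forall>P\<in>LProb \<rho>. \<forall>Q\<in>LProb \<rho>. \<forall>X\<in>under_obj \<rho> P. \<forall>Y\<in>under_obj \<rho> Q.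
      h (LProb_tensor P Q) (tensor_map P Q X Y) = h P X \<otimes>\<^bsub>W\<^esub> h Q Y) \<and>
    h LProb_unit (under_unit LProb_unit) = \<one>\<^bsub>W\<^esub>"

definition ic_entropy ::
  "real \<Rightarrow> 'w ord_monoid \<Rightarrow> ('u::points pmf \<Rightarrow> ('u \<Rightarrow> 'u) \<Rightarrow> 'w) \<Rightarrow> bool" where
  "ic_entropy \<rho> W h \<longleftrightarrow> W \<in> IcOrdCMon \<and> entropy_into \<rho> W h"

definition baseless_ic_entropy :: "real \<Rightarrow> 'w ord_monoid \<Rightarrow> ('u::points pmf \<Rightarrow> 'w) \<Rightarrow> bool" where
  "baseless_ic_entropy \<rho> W H \<longleftrightarrow>
    (\<exists>h. ic_entropy \<rho> W h \<and> (\<forall>P\<in>LProb \<rho>. H P = h P (LProb_id P)))"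

text \<open>
  The type argument is the type in which the carriers of the competing monoids live; a statement
  that leaves it a type variable is about all of them.
\<close>

definition universal_ic_entropy ::
  "'v itself \<Rightarrow> real \<Rightarrow> 'w ord_monoid \<Rightarrow> ('u::points pmf \<Rightarrow> ('u \<Rightarrow> 'u) \<Rightarrow> 'w) \<Rightarrow> bool" where
  "universal_ic_entropy TYPE('v) \<rho> W h \<longleftrightarrow>
    ic_entropy \<rho> W h \<and>
    (\<forall>(W' :: 'v ord_monoid) h'. ic_entropy \<rho> W' h' \<longrightarrow>
      (\<exists>!t. t \<in> OrdCMon_hom W W' \<and>
        (\<forall>P\<in>LProb \<rho>. \<forall>X\<in>under_obj \<rho> P. h' P X = t (h P X))))"

definition universal_baseless_ic_entropy ::
  "'v itself \<Rightarrow> real \<Rightarrow> 'w ord_monoid \<Rightarrow> ('u::points pmf \<Rightarrow> 'w) \<Rightarrow> bool" where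
  "universal_baseless_ic_entropy TYPE('v) \<rho> W H \<longleftrightarrow>
    baseless_ic_entropy \<rho> W H \<and>
    (\<forall>(W' :: 'v ord_monoid) H'. baseless_ic_entropy \<rho> W' H' \<longrightarrow>
      (\<exists>!t. t \<in> OrdCMon_hom W W' \<and> (\<forall>P\<in>LProb \<rho>. H' P = t (H P))))"


section \<open>Hartley and Shannon entropy\<close>

definition H0 :: "'u pmf \<Rightarrow> real" where
  "H0 P = ln (real (card (set_pmf P)))"

text \<open>The sum converges for \<open>P\<close> in \<open>LProb \<rho>\<close> with \<open>\<rho> < 1\<close>; it need not for \<open>\<rho> \<ge> 1\<close>.\<close>

definition H1 :: "'u pmf \<Rightarrow> real" where
  "H1 P = - (\<Sum>\<^sub>\<infinity>x\<in>set_pmf P. pmf P x * ln (pmf P x))"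

definition H0_H1_FinProb :: "'u::points itself \<Rightarrow> (real \<times> real) set" where
  "H0_H1_FinProb TYPE('u) = (\<lambda>P. (H0 P, H1 P)) ` (FinProb :: 'u pmf set)"

end

theory Submission
  imports Defs "HOL-Number_Theory.Cong"
begin

text \<open>
  Let \<open>H\<close> be an entropy into an integrally closed monoid; it suffices to show that \<open>H P \<ge> H Q\<close>
  whenever the claimed universal entropy of \<open>P\<close> is at least that of \<open>Q\<close>. Integral closedness
  allows a comparison of large powers up to a bounded or relatively small error.

  If letters \<open>X\<^sub>1, \<dots>, X\<^sub>N\<close> determine \<open>T\<close> and the average of their laws is \<open>P\<close>, then
  \<open>N H(P) \<ge> H(T)\<close>: after a random cyclic shift every letter has law \<open>P\<close>, and subadditivity applies.
  For finite \<open>P\<close> and \<open>Q\<close> with \<open>H\<^sub>1(P) > H\<^sub>1(Q)\<close> and \<open>H\<^sub>0(P) \<ge> H\<^sub>0(Q)\<close>, typical sequences of \<open>Q\<close> are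
  encoded by typical sequences of \<open>P\<close> and the remaining ones, of small total probability, by
  arbitrary sequences, for which \<open>H\<^sub>0(P) \<ge> H\<^sub>0(Q)\<close> leaves enough room. A few further letters make
  the average law exactly \<open>P\<close>.

  For \<open>\<rho> > 0\<close>, one distribution with infinite support maps onto distributions with arbitrarily large
  supports, so at bounded cost the condition on \<open>H\<^sub>0\<close> disappears. Likewise all powers of \<open>Q\<close> have
  tails that are images of a single distribution, which reduces infinite \<open>Q\<close> to finite ones. For
  \<open>\<rho> \<ge> 1\<close> there are distributions with images of arbitrarily large Shannon entropy, and so \<open>H = 0\<close>.
\<close>

section \<open>Sums over the support as expectations; images, products and powers of
  distributions\<close>

text \<open>Lets the sums defining \<open>LProb\<close> and \<open>H1\<close> be handled as
  integrals, for which rules on images and products are available.\<close>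

lemma integrable_measure_pmf_iff_summable:
  fixes f :: "'a \<Rightarrow> real"
  shows "integrable (measure_pmf P) f \<longleftrightarrow> (\<lambda>x. pmf P x * \<bar>f x\<bar>) summable_on set_pmf P"
proof -
  have "integrable (measure_pmf P) f \<longleftrightarrow> integrable (count_space UNIV) (\<lambda>x. pmf P x * f x)"
    by (subst measure_pmf_eq_density, subst integrable_density) auto
  also have "\<dots> \<longleftrightarrow> Infinite_Set_Sum.abs_summable_on (\<lambda>x. pmf P x * f x) UNIV"
    by (simp add: Infinite_Set_Sum.abs_summable_on_def)
  also have "\<dots> \<longleftrightarrow> (\<lambda>x. norm (pmf P x * f x)) summable_on UNIV"
    by (simp only: abs_summable_equivalent)
  also have "\<dots> \<longleftrightarrow> (\<lambda>x. pmf P x * \<bar>f x\<bar>) summable_on set_pmf P"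
    by (rule summable_on_cong_neutral) (auto simp: abs_mult set_pmf_iff)
  finally show ?thesis .
qed

lemma expectation_eq_infsum:
  fixes f :: "'a \<Rightarrow> real"
  assumes "integrable (measure_pmf P) f"
  shows "measure_pmf.expectation P f = (\<Sum>\<^sub>\<infinity>x\<in>set_pmf P. pmf P x * f x)"
proof -
  have "Infinite_Set_Sum.abs_summable_on (\<lambda>x. pmf P x * f x) UNIV"
    using assms unfolding Infinite_Set_Sum.abs_summable_on_def
    by (subst (asm) measure_pmf_eq_density, subst (asm) integrable_density) auto
  then have "measure_pmf.expectation P f = (\<Sum>\<^sub>\<infinity>x. pmf P x * f x)"
    by (simp add: pmf_expectation_eq_infsetsum infsetsum_infsum)
  also have "\<dots> = (\<Sum>\<^sub>\<infinity>x\<in>set_pmf P. pmf P x * f x)"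
    by (rule infsum_cong_neutral) (auto simp: set_pmf_iff)
  finally show ?thesis .
qed

lemma pmf_le_pmf_map: "pmf P x \<le> pmf (map_pmf f P) (f x)"
proof -
  have "pmf P x = measure P {x}" by (simp add: measure_pmf_single)
  also have "\<dots> \<le> measure P (f -` {f x})" by (rule measure_pmf.finite_measure_mono) auto
  finally show ?thesis by (simp add: pmf_map)
qed

text \<open>One factor of \<rho>-th power is split off as the weight of an expectation:
  \<open>p powr \<rho> = p * p powr (\<rho> - 1)\<close>.\<close>

lemma LProb_iff_integrable:
  "P \<in> LProb \<rho> \<longleftrightarrow> integrable (measure_pmf P) (\<lambda>x. pmf P x powr (\<rho> - 1))"
proof -
  have "(\<lambda>x. pmf P x powr \<rho>) summable_on set_pmf P \<longleftrightarrow>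
        (\<lambda>x. pmf P x * \<bar>pmf P x powr (\<rho> - 1)\<bar>) summable_on set_pmf P"
    by (rule summable_on_cong) (auto simp: powr_diff set_pmf_iff)
  then show ?thesis
    by (simp add: LProb_def integrable_measure_pmf_iff_summable)
qed

lemma LProb_eq_UNIV: "\<rho> \<ge> 1 \<Longrightarrow> P \<in> LProb \<rho>"
  unfolding LProb_iff_integrable
  by (rule measure_pmf.integrable_const_bound[where B = 1]) (auto intro!: powr_le1 simp: pmf_le_1)

lemma FinProb_imp_LProb: "finite (set_pmf P) \<Longrightarrow> P \<in> LProb \<rho>"
  by (simp add: LProb_iff_integrable integrable_measure_pmf_finite)

text \<open>For \<rho> < 1 the integrand \<open>p powr (\<rho> - 1)\<close> decreases in p, and
  merging points can only raise their probability.\<close>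

lemma LProb_map: "P \<in> LProb \<rho> \<Longrightarrow> map_pmf f P \<in> LProb \<rho>"
proof (cases "\<rho> \<ge> 1")
  case False
  assume "P \<in> LProb \<rho>"
  then have "integrable (measure_pmf P) (\<lambda>x. pmf P x powr (\<rho> - 1))" by (simp add: LProb_iff_integrable)
  then have "integrable (measure_pmf P) (\<lambda>x. pmf (map_pmf f P) (f x) powr (\<rho> - 1))"
  proof (rule Bochner_Integration.integrable_bound)
    show "AE x in measure_pmf P. norm (pmf (map_pmf f P) (f x) powr (\<rho> - 1)) \<le> norm (pmf P x powr (\<rho> - 1))"
      using False by (auto intro!: AE_pmfI powr_mono2' simp: pmf_le_pmf_map pmf_positive)
  qed simp
  then show ?thesis by (simp add: LProb_iff_integrable integrable_map_pmf_eq)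
qed (simp add: LProb_eq_UNIV)

text \<open>By Tonelli the integral of the absolute value factors into two finite integrals.\<close>

lemma integrable_pair_pmf_mult:
  fixes f :: "'a \<Rightarrow> real" and g :: "'b \<Rightarrow> real"
  assumes "integrable (measure_pmf P) f" "integrable (measure_pmf Q) g"
  shows "integrable (measure_pmf (pair_pmf P Q)) (\<lambda>z. f (fst z) * g (snd z))"
proof (rule integrableI_bounded)
  have "(\<integral>\<^sup>+z. ennreal (norm (f (fst z) * g (snd z))) \<partial>measure_pmf (pair_pmf P Q)) =
        (\<integral>\<^sup>+x. \<integral>\<^sup>+y. ennreal (norm (f x)) * ennreal (norm (g y)) \<partial>measure_pmf Q \<partial>measure_pmf P)"
    by (simp add: nn_integral_pair_pmf' abs_mult ennreal_mult)
  also have "\<dots> = (\<integral>\<^sup>+x. ennreal (norm (f x)) \<partial>measure_pmf P) * (\<integral>\<^sup>+y. ennreal (norm (g y)) \<partial>measure_pmf Q)"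
    by (simp add: nn_integral_cmult nn_integral_multc)
  also have "\<dots> < \<infinity>"
    using assms by (auto simp: integrable_iff_bounded ennreal_mult_less_top)
  finally show "(\<integral>\<^sup>+z. ennreal (norm (f (fst z) * g (snd z))) \<partial>measure_pmf (pair_pmf P Q)) < \<infinity>" .
qed simp

lemma LProb_pair:
  assumes "P \<in> LProb \<rho>" "Q \<in> LProb \<rho>" shows "pair_pmf P Q \<in> LProb \<rho>"
proof -
  have "pmf (pair_pmf P Q) z powr (\<rho> - 1) = pmf P (fst z) powr (\<rho> - 1) * pmf Q (snd z) powr (\<rho> - 1)" for z
    by (cases z) (simp add: pmf_pair powr_mult)
  with integrable_pair_pmf_mult assms show ?thesis
    by (simp add: LProb_iff_integrable)
qed

lemma replicate_pmf_Suc_conv_pair: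
  "replicate_pmf (Suc n) P = map_pmf (\<lambda>(x, xs). x # xs) (pair_pmf P (replicate_pmf n P))"
  by (simp add: pair_pmf_def map_bind_pmf)

lemma LProb_replicate: "P \<in> LProb \<rho> \<Longrightarrow> replicate_pmf n P \<in> LProb \<rho>"
proof (induction n)
  case (Suc n)
  then show ?case unfolding replicate_pmf_Suc_conv_pair by (intro LProb_map LProb_pair)
qed (simp add: FinProb_imp_LProb)

lemma map_nth_replicate_pmf: "i < n \<Longrightarrow> map_pmf (\<lambda>xs. xs ! i) (replicate_pmf n P) = P"
proof (induction n arbitrary: i)
  case (Suc n)
  show ?case
  proof (cases i)
    case 0
    then show ?thesis
      by (simp add: map_bind_pmf bind_return_pmf')
  next
    case (Suc j)
    have "map_pmf (\<lambda>xs. xs ! i) (replicate_pmf (Suc n) P) =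
          map_pmf (\<lambda>xs. xs ! j) (map_pmf snd (pair_pmf P (replicate_pmf n P)))"
      unfolding replicate_pmf_Suc_conv_pair pmf.map_comp by (simp add: Suc o_def split_def)
    then show ?thesis using Suc.IH[of j] Suc.prems Suc by (simp add: map_snd_pair_pmf)
  qed
qed simp

section \<open>Shannon entropy as an expectation\<close>

text \<open>Excludes the junk value 0 that \<open>H1\<close> takes when its series diverges.\<close>

definition fin_H1 :: "'a pmf \<Rightarrow> bool" where
  "fin_H1 P \<longleftrightarrow> integrable (measure_pmf P) (\<lambda>x. ln (pmf P x))"

lemma fin_H1_finite: "finite (set_pmf P) \<Longrightarrow> fin_H1 P"
  by (simp add: fin_H1_def integrable_measure_pmf_finite)

text \<open>The bound ln t \<le> t - 1 at \<open>t = p powr (\<rho> - 1)\<close> dominates the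
  logarithm by a multiple of the integrand that defines \<open>LProb \<rho>\<close>.\<close>

lemma fin_H1_LProb:
  assumes "\<rho> < 1" "P \<in> LProb \<rho>" shows "fin_H1 P"
  unfolding fin_H1_def
proof (rule Bochner_Integration.integrable_bound)
  show "integrable (measure_pmf P) (\<lambda>x. pmf P x powr (\<rho> - 1) / (1 - \<rho>))"
    using assms by (simp add: LProb_iff_integrable)
  have "\<bar>ln p\<bar> \<le> p powr (\<rho> - 1) / (1 - \<rho>)" if "0 < p" "p \<le> 1" for p :: real
  proof -
    have "(1 - \<rho>) * - ln p = ln (p powr (\<rho> - 1))" using that by (simp add: ln_powr algebra_simps)
    also have "\<dots> \<le> p powr (\<rho> - 1) - 1" using that by (intro ln_le_minus_one) auto
    finally have "(1 - \<rho>) * - ln p \<le> p powr (\<rho> - 1)" by linarith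
    then have "- ln p \<le> p powr (\<rho> - 1) / (1 - \<rho>)"
      using assms by (simp add: pos_le_divide_eq mult.commute)
    then show ?thesis using that by simp
  qed
  then show "AE x in measure_pmf P. norm (ln (pmf P x)) \<le> norm (pmf P x powr (\<rho> - 1) / (1 - \<rho>))"
    using assms by (auto intro!: AE_pmfI simp: pmf_positive pmf_le_1)
qed simp

lemma H1_eq_expectation:
  "fin_H1 P \<Longrightarrow> H1 P = measure_pmf.expectation P (\<lambda>x. - ln (pmf P x))"
  by (simp add: H1_def fin_H1_def expectation_eq_infsum)

lemma ln_pmf_nonpos: "ln (pmf P x) \<le> 0"
  by (cases "pmf P x = 0") (auto simp: pmf_le_1 pmf_pos)

lemma fin_H1_map: "fin_H1 P \<Longrightarrow> fin_H1 (map_pmf f P)"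
  unfolding fin_H1_def integrable_map_pmf_eq
proof (erule Bochner_Integration.integrable_bound)
  show "AE x in measure_pmf P. norm (ln (pmf (map_pmf f P) (f x))) \<le> norm (ln (pmf P x))"
    by (auto intro!: AE_pmfI simp: abs_of_nonpos ln_pmf_nonpos pmf_le_pmf_map pmf_positive
        intro: order_less_le_trans[OF _ pmf_le_pmf_map])
qed simp

lemma H1_nonneg: "fin_H1 P \<Longrightarrow> 0 \<le> H1 P"
  by (simp add: H1_eq_expectation fin_H1_def del: Bochner_Integration.integral_minus)
     (intro integral_nonneg_AE, simp add: ln_pmf_nonpos)

text \<open>The inequality holds pointwise, because \<open>f x\<close> is at least as probable as
  \<open>x\<close>.\<close>

lemma H1_map_le:
  assumes "fin_H1 P" shows "H1 (map_pmf f P) \<le> H1 P"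
proof -
  have "measure_pmf.expectation P (\<lambda>x. - ln (pmf (map_pmf f P) (f x))) \<le>
        measure_pmf.expectation P (\<lambda>x. - ln (pmf P x))"
    using assms fin_H1_map[OF assms, of f] unfolding fin_H1_def integrable_map_pmf_eq
    by (intro integral_mono_AE)
       (auto intro!: AE_pmfI simp: pmf_le_pmf_map pmf_positive
         intro: order_less_le_trans[OF _ pmf_le_pmf_map])
  then show ?thesis using assms by (simp add: H1_eq_expectation fin_H1_map)
qed

lemma H1_map_inj:
  assumes "inj_on f (set_pmf P)" "fin_H1 P" shows "H1 (map_pmf f P) = H1 P"
proof -
  have "measure_pmf.expectation P (\<lambda>x. - ln (pmf (map_pmf f P) (f x))) =
        measure_pmf.expectation P (\<lambda>x. - ln (pmf P x))"
    using assms by (intro integral_cong_AE) (auto intro!: AE_pmfI simp: pmf_map_inj)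
  then show ?thesis using assms by (simp add: H1_eq_expectation fin_H1_map)
qed

lemma
  assumes "fin_H1 P" "fin_H1 Q"
  shows fin_H1_pair: "fin_H1 (pair_pmf P Q)"
    and H1_pair: "H1 (pair_pmf P Q) = H1 P + H1 Q"
proof -
  have P: "integrable (measure_pmf (pair_pmf P Q)) (\<lambda>z. ln (pmf P (fst z)))"
    and eP: "measure_pmf.expectation (pair_pmf P Q) (\<lambda>z. ln (pmf P (fst z))) = measure_pmf.expectation P (\<lambda>x. ln (pmf P x))"
    using assms integrable_map_pmf_eq[of fst "pair_pmf P Q" "\<lambda>x. ln (pmf P x)"]
      integral_map_pmf[of fst "pair_pmf P Q" "\<lambda>x. ln (pmf P x)"]
    by (auto simp: fin_H1_def map_fst_pair_pmf)
  have Q: "integrable (measure_pmf (pair_pmf P Q)) (\<lambda>z. ln (pmf Q (snd z)))"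
    and eQ: "measure_pmf.expectation (pair_pmf P Q) (\<lambda>z. ln (pmf Q (snd z))) = measure_pmf.expectation Q (\<lambda>x. ln (pmf Q x))"
    using assms integrable_map_pmf_eq[of snd "pair_pmf P Q" "\<lambda>x. ln (pmf Q x)"]
      integral_map_pmf[of snd "pair_pmf P Q" "\<lambda>x. ln (pmf Q x)"]
    by (auto simp: fin_H1_def map_snd_pair_pmf)
  have ae: "AE z in measure_pmf (pair_pmf P Q). ln (pmf (pair_pmf P Q) z) = ln (pmf P (fst z)) + ln (pmf Q (snd z))"
    by (auto intro!: AE_pmfI simp: pmf_pair ln_mult set_pmf_iff)
  have int: "integrable (measure_pmf (pair_pmf P Q)) (\<lambda>z. ln (pmf P (fst z)) + ln (pmf Q (snd z)))"
    using P Q by simp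
  show fin: "fin_H1 (pair_pmf P Q)"
    unfolding fin_H1_def by (rule integrable_cong_AE_imp[OF int]) (use ae in auto)
  have "measure_pmf.expectation (pair_pmf P Q) (\<lambda>z. ln (pmf (pair_pmf P Q) z)) =
     measure_pmf.expectation (pair_pmf P Q) (\<lambda>z. ln (pmf P (fst z)) + ln (pmf Q (snd z)))"
    by (rule integral_cong_AE) (use ae in auto)
  then show "H1 (pair_pmf P Q) = H1 P + H1 Q"
    using assms fin P Q by (simp add: H1_eq_expectation eP eQ)
qed

text \<open>Apply ln t \<le> t - 1 to t = K/J. Under J, the ratio K/J has expectation at most 1, the
  total mass of K.\<close>

lemma gibbs_inequality:
  assumes "integrable (measure_pmf J) (\<lambda>x. ln (pmf J x))" "integrable (measure_pmf J) (\<lambda>x. ln (pmf K x))"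
    and sub: "set_pmf J \<subseteq> set_pmf K"
  shows "measure_pmf.expectation J (\<lambda>x. ln (pmf K x)) \<le> measure_pmf.expectation J (\<lambda>x. ln (pmf J x))"
proof -
  have "(\<integral>\<^sup>+x. ennreal (pmf K x / pmf J x) \<partial>measure_pmf J) \<le> (\<integral>\<^sup>+x. ennreal (pmf K x) \<partial>count_space UNIV)"
    unfolding nn_integral_measure_pmf by (intro nn_integral_mono) (auto simp flip: ennreal_mult)
  also have "\<dots> = 1" by (simp add: nn_integral_pmf_eq_1)
  finally have le: "(\<integral>\<^sup>+x. ennreal (pmf K x / pmf J x) \<partial>measure_pmf J) \<le> 1" .
  have int: "integrable (measure_pmf J) (\<lambda>x. pmf K x / pmf J x)"
    by (rule integrableI_bounded) (auto intro: le_less_trans[OF le])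
  have "ennreal (measure_pmf.expectation J (\<lambda>x. pmf K x / pmf J x)) \<le> 1"
    using le by (subst nn_integral_eq_integral[symmetric]) (auto simp: int)
  then have 1: "measure_pmf.expectation J (\<lambda>x. pmf K x / pmf J x) \<le> 1"
    by (simp flip: ennreal_1)
  have "measure_pmf.expectation J (\<lambda>x. ln (pmf K x) - ln (pmf J x)) \<le>
        measure_pmf.expectation J (\<lambda>x. pmf K x / pmf J x - 1)"
  proof (intro integral_mono_AE AE_pmfI)
    fix x assume x: "x \<in> set_pmf J"
    then have pos: "pmf J x > 0" "pmf K x > 0" using sub by (auto simp: pmf_positive)
    then have "ln (pmf K x / pmf J x) \<le> pmf K x / pmf J x - 1" by (intro ln_le_minus_one) auto
    then show "ln (pmf K x) - ln (pmf J x) \<le> pmf K x / pmf J x - 1" using pos by (simp add: ln_div)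
  qed (use assms int in auto)
  also have "\<dots> \<le> 0" using 1 int by simp
  finally show ?thesis using assms by simp
qed

text \<open>Gibbs' inequality for the joint law \<open>J\<close> against the product
  \<open>K\<close> of its marginals, whose logarithm splits into two terms.\<close>

lemma H1_joint_le:
  assumes "fin_H1 R"
  shows "H1 (map_pmf (\<lambda>\<omega>. (X \<omega>, Y \<omega>)) R) \<le> H1 (map_pmf X R) + H1 (map_pmf Y R)"
proof -
  define J K where "J = map_pmf (\<lambda>\<omega>. (X \<omega>, Y \<omega>)) R" and "K = pair_pmf (map_pmf X R) (map_pmf Y R)"
  have fJ: "fin_H1 J" and fX: "fin_H1 (map_pmf X R)" and fY: "fin_H1 (map_pmf Y R)"
    using assms by (auto simp: J_def fin_H1_map)
  have iX: "integrable (measure_pmf R) (\<lambda>\<omega>. ln (pmf (map_pmf X R) (X \<omega>)))"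
    and iY: "integrable (measure_pmf R) (\<lambda>\<omega>. ln (pmf (map_pmf Y R) (Y \<omega>)))"
    using fX fY by (auto simp: fin_H1_def integrable_map_pmf_eq)
  have ae: "AE \<omega> in measure_pmf R. ln (pmf K (X \<omega>, Y \<omega>)) = ln (pmf (map_pmf X R) (X \<omega>)) + ln (pmf (map_pmf Y R) (Y \<omega>))"
    by (auto intro!: AE_pmfI simp: K_def pmf_pair ln_mult pmf_eq_0_set_pmf)
  have iK: "integrable (measure_pmf R) (\<lambda>\<omega>. ln (pmf K (X \<omega>, Y \<omega>)))"
    by (rule integrable_cong_AE_imp[OF Bochner_Integration.integrable_add[OF iX iY]]) (use ae in auto)
  have eK: "measure_pmf.expectation R (\<lambda>\<omega>. ln (pmf K (X \<omega>, Y \<omega>))) =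
      measure_pmf.expectation R (\<lambda>\<omega>. ln (pmf (map_pmf X R) (X \<omega>)) + ln (pmf (map_pmf Y R) (Y \<omega>)))"
    by (rule integral_cong_AE) (use ae in auto)
  have "measure_pmf.expectation J (\<lambda>x. ln (pmf K x)) \<le> measure_pmf.expectation J (\<lambda>x. ln (pmf J x))"
    by (rule gibbs_inequality) (use fJ iK in \<open>auto simp: fin_H1_def J_def integrable_map_pmf_eq K_def\<close>)
  then have "H1 J \<le> - measure_pmf.expectation J (\<lambda>x. ln (pmf K x))"
    using fJ by (simp add: H1_eq_expectation)
  also have "\<dots> = H1 (map_pmf X R) + H1 (map_pmf Y R)"
    using fX fY iX iY eK by (simp add: H1_eq_expectation J_def)
  finally show ?thesis by (simp add: J_def)
qed

lemma fin_H1_replicate: "fin_H1 P \<Longrightarrow> fin_H1 (replicate_pmf n P)"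
proof (induction n)
  case (Suc n)
  then show ?case unfolding replicate_pmf_Suc_conv_pair by (intro fin_H1_map fin_H1_pair)
qed (simp add: fin_H1_finite)

lemma H1_return [simp]: "H1 (return_pmf x) = 0"
  by (simp add: H1_def)

lemma H1_replicate: "fin_H1 P \<Longrightarrow> H1 (replicate_pmf n P) = real n * H1 P"
proof (induction n)
  case (Suc n)
  have "H1 (replicate_pmf (Suc n) P) = H1 (pair_pmf P (replicate_pmf n P))"
    unfolding replicate_pmf_Suc_conv_pair
    by (rule H1_map_inj) (auto simp: inj_on_def fin_H1_pair fin_H1_replicate Suc)
  then show ?case using Suc by (simp add: H1_pair fin_H1_replicate algebra_simps del: replicate_pmf.simps)
qed simp

lemma H1_finite:
  "finite (set_pmf P) \<Longrightarrow> H1 P = - (\<Sum>x\<in>set_pmf P. pmf P x * ln (pmf P x))"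
  by (simp add: H1_def)

lemma H1_pmf_of_set: "finite A \<Longrightarrow> A \<noteq> {} \<Longrightarrow> H1 (pmf_of_set A) = ln (card A)"
  by (simp add: H1_finite ln_div card_gt_0_iff)

lemma finite_set_replicate_pmf: "finite (set_pmf P) \<Longrightarrow> finite (set_pmf (replicate_pmf n P))"
  using finite_lists_length_eq[of "set_pmf P" n]
  by (rule back_subst[of finite]) (auto simp: set_replicate_pmf in_lists_conv_set)

lemma card_set_replicate_pmf: "finite (set_pmf P) \<Longrightarrow> card (set_pmf (replicate_pmf n P)) = card (set_pmf P) ^ n"
proof -
  assume "finite (set_pmf P)"
  have "set_pmf (replicate_pmf n P) = {xs. set xs \<subseteq> set_pmf P \<and> length xs = n}"
    by (auto simp: set_replicate_pmf in_lists_conv_set)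
  then show ?thesis using card_lists_length_eq[of "set_pmf P" n] \<open>finite _\<close> by simp
qed

section \<open>Baseless entropies\<close>

locale ic_monoid = ord_comm_monoid W for W :: "'w ord_monoid" (structure) +
  assumes ic: "integrally_closed W"
begin

lemma ge_refl: "x \<in> carrier W \<Longrightarrow> x \<succeq> x"
  using geq_refl by (rule reflp_onD)

lemma ge_trans: "\<lbrakk>x \<succeq> y; y \<succeq> z; x \<in> carrier W; y \<in> carrier W; z \<in> carrier W\<rbrakk> \<Longrightarrow> x \<succeq> z"
  using geq_trans by (meson transp_onD)

lemma ge_antisym: "\<lbrakk>x \<succeq> y; y \<succeq> x; x \<in> carrier W; y \<in> carrier W\<rbrakk> \<Longrightarrow> x = y"
  using geq_antisym by (meson antisymp_onD)

lemma ge_pow: "\<lbrakk>x \<succeq> y; x \<in> carrier W; y \<in> carrier W\<rbrakk> \<Longrightarrow> x [^] (n::nat) \<succeq> y [^] n"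
  by (induction n) (auto intro: geq_mult ge_refl)

text \<open>Integral closedness with a trivial error on the right. This form absorbs any cost
  \<open>a\<close> that stays the same for all n.\<close>

lemma ge_of_pow_mult:
  assumes "x \<in> carrier W" "y \<in> carrier W" "a \<in> carrier W"
    and "\<And>n::nat. n \<ge> 1 \<Longrightarrow> x [^] n \<otimes> a \<succeq> y [^] n"
  shows "x \<succeq> y"
  using ic[unfolded integrally_closed_def, rule_format, of x y a \<one>] assms by simp

lemma mult_nonneg: "\<lbrakk>x \<in> carrier W; y \<in> carrier W; y \<succeq> \<one>\<rbrakk> \<Longrightarrow> x \<otimes> y \<succeq> x"
  using geq_mult[of x x y \<one>] by (simp add: ge_refl)

lemma pow_nonneg: "\<lbrakk>y \<in> carrier W; y \<succeq> \<one>\<rbrakk> \<Longrightarrow> y [^] (n::nat) \<succeq> \<one>"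
  using ge_pow[of y \<one> n] by simp

lemma pow_mono: "\<lbrakk>y \<in> carrier W; y \<succeq> \<one>; m \<le> n\<rbrakk> \<Longrightarrow> y [^] (n::nat) \<succeq> y [^] m"
  using mult_nonneg[of "y [^] m" "y [^] (n - m)"] pow_nonneg[of y "n - m"]
  by (simp add: nat_pow_mult)

text \<open>Rounding n up to a multiple of k costs at most k further factors \<open>x\<close>, an
  error independent of n.\<close>

lemma ge_of_pow:
  assumes x: "x \<in> carrier W" "x \<succeq> \<one>" and y: "y \<in> carrier W" "y \<succeq> \<one>"
    and k: "k \<ge> 1" and le: "x [^] k \<succeq> y [^] (k::nat)"
  shows "x \<succeq> y"
proof (rule ge_of_pow_mult)
  fix n :: nat assume "n \<ge> 1"
  define q where "q = n div k + 1"
  have kq: "k * (n div k) \<le> n" "n \<le> k * q" using k dividend_less_times_div[of k n]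
    by (auto simp: q_def algebra_simps)
  have "x [^] n \<otimes> x [^] k = x [^] (n + k)" using x by (simp add: nat_pow_mult)
  moreover have "x [^] (n + k) \<succeq> x [^] (k * q)"
    by (rule pow_mono) (use x kq in \<open>auto simp: q_def algebra_simps\<close>)
  moreover have "x [^] (k * q) \<succeq> y [^] (k * q)"
    using ge_pow[OF le, of q] x y by (simp add: nat_pow_pow)
  moreover have "y [^] (k * q) \<succeq> y [^] n" by (rule pow_mono) (use y kq in auto)
  ultimately show "x [^] n \<otimes> x [^] k \<succeq> y [^] n"
    using x y by (metis ge_trans nat_pow_closed)
qed (use x y in auto)

end

lemma ic_monoid_iff: "ic_monoid W \<longleftrightarrow> W \<in> IcOrdCMon"
  by (simp add: ic_monoid_def ic_monoid_axioms_def IcOrdCMon_def OrdCMon_def)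

text \<open>Carries distributions on pairs, lists and other types into the type of points.\<close>

definition enc :: "'a pmf \<Rightarrow> 'a \<Rightarrow> 'u::points" where
  "enc R = (SOME e. inj_on e (set_pmf R))"

text \<open>The support of a \<open>pmf\<close> is countable and the type of points is infinite, so
  the choice in \<open>enc\<close> is from a nonempty set.\<close>

lemma inj_on_enc: "inj_on (enc R :: 'a \<Rightarrow> 'u::points) (set_pmf R)"
proof -
  obtain f :: "nat \<Rightarrow> 'u" where "inj f"
    using infinite_countable_subset[OF infinite_UNIV] by blast
  then have "inj_on (f \<circ> to_nat_on (set_pmf R)) (set_pmf R)"
    by (intro comp_inj_on inj_on_to_nat_on) (auto intro: inj_on_subset)
  then show ?thesis unfolding enc_def by (rule someI[of "\<lambda>e. inj_on e (set_pmf R)"])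
qed

lemma pt_pair_eq_iff [simp]: "pt_pair a b = pt_pair c d \<longleftrightarrow> a = c \<and> b = d"
  by (metis prod.inject pt_unpair_pair)

text \<open>The laws of a baseless entropy, with images of distributions in place of morphisms of
  under categories.\<close>

locale entropy = ic_monoid W for W :: "'w ord_monoid" (structure) +
  fixes \<rho> :: real and H :: "'u::points pmf \<Rightarrow> 'w"
  assumes H_carrier: "P \<in> LProb \<rho> \<Longrightarrow> H P \<in> carrier W"
    and H_map: "P \<in> LProb \<rho> \<Longrightarrow> H P \<succeq> H (map_pmf f P)"
    and H_joint: "P \<in> LProb \<rho> \<Longrightarrow>
      H (map_pmf X P) \<otimes> H (map_pmf Y P) \<succeq> H (map_pmf (\<lambda>\<omega>. pt_pair (X \<omega>) (Y \<omega>)) P)"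
    and H_tensor: "\<lbrakk>P \<in> LProb \<rho>; Q \<in> LProb \<rho>\<rbrakk> \<Longrightarrow> H (LProb_tensor P Q) = H P \<otimes> H Q"
    and H_unit: "H LProb_unit = \<one>"
begin

text \<open>Extends \<open>H\<close> to distributions on any type; by \<open>E_eq\<close> every
  other injection into the points gives the same value.\<close>

definition E :: "'a pmf \<Rightarrow> 'w" where
  "E R = H (map_pmf (enc R) R)"

lemma E_carrier: "R \<in> LProb \<rho> \<Longrightarrow> E R \<in> carrier W"
  by (simp add: E_def H_carrier LProb_map)

text \<open>On the support \<open>e'\<close> factors through the injection \<open>e\<close>, so
  \<open>map_pmf e' R\<close> is an image of \<open>map_pmf e R\<close>.\<close>

lemma H_map_inj_le:
  assumes R: "R \<in> LProb \<rho>" and e: "inj_on e (set_pmf R)"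
  shows "H (map_pmf e R) \<succeq> H (map_pmf e' R)"
proof -
  have "map_pmf (\<lambda>u. e' (inv_into (set_pmf R) e u)) (map_pmf e R) = map_pmf e' R"
    unfolding pmf.map_comp by (rule map_pmf_cong) (auto simp: e)
  then show ?thesis using H_map[OF LProb_map[OF R], of e] by metis
qed

lemma E_eq:
  assumes R: "R \<in> LProb \<rho>" and e: "inj_on e (set_pmf R)"
  shows "E R = H (map_pmf e R)"
  unfolding E_def
  by (intro ge_antisym H_map_inj_le R e inj_on_enc H_carrier LProb_map)

lemma E_eq_H: "P \<in> LProb \<rho> \<Longrightarrow> E P = H P"
  using E_eq[of P "\<lambda>x. x"] by simp

lemma E_map_le:
  assumes "R \<in> LProb \<rho>" shows "E R \<succeq> E (map_pmf f R)"
  unfolding E_def pmf.map_comp by (rule H_map_inj_le[OF assms inj_on_enc])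

lemma E_map_inj:
  assumes "R \<in> LProb \<rho>" "inj_on f (set_pmf R)" shows "E (map_pmf f R) = E R"
proof -
  have "inj_on (enc (map_pmf f R) \<circ> f) (set_pmf R)"
    using inj_on_enc[of "map_pmf f R"] by (intro comp_inj_on assms) simp
  from E_eq[OF assms(1) this] show ?thesis by (simp add: E_def[of "map_pmf f R"] pmf.map_comp)
qed

text \<open>On the support \<open>Y\<close> factors through \<open>X\<close>, so the law of
  \<open>Y\<close> is an image of the law of \<open>X\<close>.\<close>

lemma E_map_determined:
  assumes "R \<in> LProb \<rho>"
    and "\<And>\<omega> \<omega>'. \<lbrakk>\<omega> \<in> set_pmf R; \<omega>' \<in> set_pmf R; X \<omega> = X \<omega>'\<rbrakk> \<Longrightarrow> Y \<omega> = Y \<omega>'"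
  shows "E (map_pmf X R) \<succeq> E (map_pmf Y R)"
proof -
  define g where "g v = Y (SOME \<omega>. \<omega> \<in> set_pmf R \<and> X \<omega> = v)" for v
  have "g (X \<omega>) = Y \<omega>" if "\<omega> \<in> set_pmf R" for \<omega>
    unfolding g_def using someI[of "\<lambda>\<omega>'. \<omega>' \<in> set_pmf R \<and> X \<omega>' = X \<omega>" \<omega>] that
    by (intro assms(2)) auto
  then have "map_pmf g (map_pmf X R) = map_pmf Y R"
    unfolding pmf.map_comp by (intro map_pmf_cong) auto
  then show ?thesis using E_map_le[OF LProb_map[OF assms(1)], of X g] by simp
qed

lemma E_pair:
  assumes P: "P \<in> LProb \<rho>" and Q: "Q \<in> LProb \<rho>" shows "E (pair_pmf P Q) = E P \<otimes> E Q"
proof -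
  let ?e = "\<lambda>(x, y). pt_pair (enc P x) (enc Q y) :: 'u"
  have inj: "inj_on ?e (set_pmf (pair_pmf P Q))"
    by (auto simp: inj_on_def inj_on_enc[THEN inj_on_eq_iff])
  have "map_pmf ?e (pair_pmf P Q) = LProb_tensor (map_pmf (enc P) P) (map_pmf (enc Q) Q)"
    by (simp add: LProb_tensor_def map_pair[symmetric] pmf.map_comp o_def split_def)
  then show ?thesis
    using E_eq[OF LProb_pair[OF P Q] inj] H_tensor[OF LProb_map LProb_map, OF P Q] by (simp add: E_def)
qed

text \<open>\<open>H_joint\<close> speaks of points only: decode with \<open>?d\<close>, apply
  \<open>X\<close> or \<open>Y\<close>, and encode the values by \<open>eX\<close> and
  \<open>eY\<close>.\<close>

lemma E_joint:
  assumes "R \<in> LProb \<rho>"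
  shows "E (map_pmf X R) \<otimes> E (map_pmf Y R) \<succeq> E (map_pmf (\<lambda>\<omega>. (X \<omega>, Y \<omega>)) R)"
proof -
  let ?R = "map_pmf (enc R) R :: 'u pmf" and ?d = "inv_into (set_pmf R) (enc R)"
  let ?J = "map_pmf (\<lambda>\<omega>. (X \<omega>, Y \<omega>)) R"
  define eX :: "_ \<Rightarrow> 'u" where "eX = enc (map_pmf X R)"
  define eY :: "_ \<Rightarrow> 'u" where "eY = enc (map_pmf Y R)"
  have inj: "inj_on (\<lambda>(x, y). pt_pair (eX x) (eY y)) (set_pmf ?J)"
    using inj_on_enc[of "map_pmf X R"] inj_on_enc[of "map_pmf Y R"]
    unfolding eX_def eY_def by (auto simp: inj_on_def)
  have dec: "map_pmf (\<lambda>u. f (?d u)) ?R = map_pmf f R" for f :: "_ \<Rightarrow> 'u"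
    unfolding pmf.map_comp by (intro map_pmf_cong) (auto simp: inj_on_enc)
  have "H (map_pmf (\<lambda>u. eX (X (?d u))) ?R) \<otimes> H (map_pmf (\<lambda>u. eY (Y (?d u))) ?R) \<succeq>
        H (map_pmf (\<lambda>u. pt_pair (eX (X (?d u))) (eY (Y (?d u)))) ?R)"
    by (rule H_joint) (simp add: LProb_map assms)
  then have "H (map_pmf (\<lambda>\<omega>. eX (X \<omega>)) R) \<otimes> H (map_pmf (\<lambda>\<omega>. eY (Y \<omega>)) R) \<succeq>
        H (map_pmf (\<lambda>\<omega>. pt_pair (eX (X \<omega>)) (eY (Y \<omega>))) R)"
    using dec[of "\<lambda>\<omega>. eX (X \<omega>)"] dec[of "\<lambda>\<omega>. eY (Y \<omega>)"] dec[of "\<lambda>\<omega>. pt_pair (eX (X \<omega>)) (eY (Y \<omega>))"]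
    by simp
  moreover have "E ?J = H (map_pmf (\<lambda>\<omega>. pt_pair (eX (X \<omega>)) (eY (Y \<omega>))) R)"
    using E_eq[OF LProb_map[OF assms] inj] by (simp add: pmf.map_comp o_def)
  ultimately show ?thesis
    by (simp add: E_def eX_def eY_def pmf.map_comp o_def)
qed

lemma E_return [simp]: "E (return_pmf x) = \<one>"
  using E_eq[of "return_pmf x" "\<lambda>_. point"] H_unit by (simp add: FinProb_imp_LProb LProb_unit_def)

text \<open>Every distribution maps onto a one-point distribution, whose value is \<one>.\<close>

lemma E_nonneg: "R \<in> LProb \<rho> \<Longrightarrow> E R \<succeq> \<one>"
  using E_map_le[of R "\<lambda>_. ()"] by (simp add: map_pmf_const)

lemma E_replicate: "P \<in> LProb \<rho> \<Longrightarrow> E (replicate_pmf n P) = E P [^] n"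
proof (induction n)
  case (Suc n)
  have "E (replicate_pmf (Suc n) P) = E (pair_pmf P (replicate_pmf n P))"
    unfolding replicate_pmf_Suc_conv_pair
    by (intro E_map_inj LProb_pair LProb_replicate Suc.prems) (auto simp: inj_on_def)
  then show ?case using Suc
    by (simp add: E_pair LProb_replicate E_carrier m_comm del: replicate_pmf.simps)
qed simp

text \<open>One use of subadditivity per variable, each of which contributes the same
  \<open>E P\<close>.\<close>

lemma E_joint_list:
  assumes R: "R \<in> LProb \<rho>" and Xs: "\<And>X. X \<in> set Xs \<Longrightarrow> map_pmf X R = P" and P: "P \<in> LProb \<rho>"
  shows "E P [^] length Xs \<succeq> E (map_pmf (\<lambda>\<omega>. map (\<lambda>X. X \<omega>) Xs) R)"
  using Xs
proof (induction Xs)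
  case Nil
  then show ?case by (simp add: map_pmf_const ge_refl)
next
  case (Cons X Xs)
  let ?J = "\<lambda>\<omega>. map (\<lambda>X. X \<omega>) Xs"
  have c: "E (map_pmf f R) \<in> carrier W" for f :: "_ \<Rightarrow> 'z" by (intro E_carrier LProb_map R)
  have "E P [^] length Xs \<otimes> E P \<succeq> E (map_pmf ?J R) \<otimes> E (map_pmf X R)"
    using Cons by (intro geq_mult) (auto simp: E_carrier LProb_map R P intro!: ge_refl)
  moreover have "E (map_pmf ?J R) \<otimes> E (map_pmf X R) \<succeq> E (map_pmf (\<lambda>\<omega>. (?J \<omega>, X \<omega>)) R)"
    by (rule E_joint[OF R])
  moreover have "E (map_pmf (\<lambda>\<omega>. (?J \<omega>, X \<omega>)) R) \<succeq> E (map_pmf (\<lambda>\<omega>. map (\<lambda>X. X \<omega>) (X # Xs)) R)"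
    by (rule E_map_determined[OF R]) auto
  ultimately have "E P [^] length Xs \<otimes> E P \<succeq> E (map_pmf (\<lambda>\<omega>. map (\<lambda>X. X \<omega>) (X # Xs)) R)"
    using ge_trans E_carrier LProb_map R P by (metis (no_types, lifting) m_closed nat_pow_closed)
  then show ?case by simp
qed

end

section \<open>Encoding by letters of prescribed average law\<close>

lemma map_replicate_pmf: "map_pmf (map T) (replicate_pmf n R) = replicate_pmf n (map_pmf T R)"
proof (induction n)
  case (Suc n)
  show ?case by (simp add: map_bind_pmf bind_map_pmf flip: Suc)
qed simp

text \<open>Conditioning on the uniform first component exhibits the law as an average.\<close>

lemma pmf_map_pair:
  assumes "finite A" "A \<noteq> {}"
  shows "pmf (map_pmf f (pair_pmf (pmf_of_set A) R)) x = (\<Sum>k\<in>A. pmf (map_pmf (\<lambda>\<omega>. f (k, \<omega>)) R) x) / card A"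
proof -
  have "map_pmf f (pair_pmf (pmf_of_set A) R) = bind_pmf (pmf_of_set A) (\<lambda>k. map_pmf (\<lambda>\<omega>. f (k, \<omega>)) R)"
    by (simp add: pair_pmf_def map_bind_pmf map_pmf_def bind_assoc_pmf bind_return_pmf)
  then show ?thesis using assms by (simp add: pmf_bind_pmf_of_set)
qed

context entropy
begin

text \<open>The letters are shifted cyclically by a common uniform \<open>k\<close>, after which each of them has
  law \<open>P\<close>. The cost of \<open>k\<close> is spread over \<open>M\<close> independent copies that share it.\<close>

lemma E_average_law:
  fixes L :: "nat \<Rightarrow> 'r \<Rightarrow> 'a"
  assumes R: "R \<in> LProb \<rho>" and P: "P \<in> LProb \<rho>" and N: "N \<ge> 1"
    and avg: "\<And>a. (\<Sum>i<N. pmf (map_pmf (L i) R) a) = real N * pmf P a"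
    and det: "\<And>\<omega> \<omega>'. \<lbrakk>\<omega> \<in> set_pmf R; \<omega>' \<in> set_pmf R; \<And>i. i < N \<Longrightarrow> L i \<omega> = L i \<omega>'\<rbrakk> \<Longrightarrow> T \<omega> = T \<omega>'"
  shows "E P [^] N \<succeq> E (map_pmf T R)"
proof (rule ge_of_pow_mult)
  let ?U = "pmf_of_set {..<N}"
  have U: "?U \<in> LProb \<rho>" and ne: "{..<N} \<noteq> {}"
    using N by (auto intro!: FinProb_imp_LProb simp: lessThan_empty_iff)
  show "E P [^] N \<in> carrier W" "E (map_pmf T R) \<in> carrier W" "E ?U \<in> carrier W"
    using P R U by (auto simp: E_carrier LProb_map)
  fix M :: nat
  define B where "B = pair_pmf ?U (replicate_pmf M R)"
  have B: "B \<in> LProb \<rho>" unfolding B_def by (intro LProb_pair LProb_replicate U R)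
  \<comment> \<open>Letter \<open>j\<close> of copy \<open>c\<close> is read at position
    \<open>(j + k) mod N\<close>, with the same \<open>k\<close> in all \<open>M\<close>
    copies.\<close>
  define Xs where "Xs = [\<lambda>(k, \<omega>). L ((j + k) mod N) (\<omega> ! c). (c, j) \<leftarrow> List.product [0..<M] [0..<N]]"
  have len: "length Xs = N * M" by (simp add: Xs_def)
  have shift: "bij_betw (\<lambda>k. (j + k) mod N) {..<N} {..<N}" for j
  proof -
    have "inj_on (\<lambda>k. (j + k) mod N) {..<N}"
    proof (rule inj_onI)
      fix x y assume "x \<in> {..<N}" "y \<in> {..<N}" "(j + x) mod N = (j + y) mod N"
      then have "[j + x = j + y] (mod N)" by (simp add: cong_def)
      then have "[x = y] (mod N)" by (simp add: cong_add_lcancel_nat)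
      then show "x = y" using \<open>x \<in> _\<close> \<open>y \<in> _\<close> by (simp add: cong_def)
    qed
    moreover have "(\<lambda>k. (j + k) mod N) ` {..<N} \<subseteq> {..<N}" using N by auto
    ultimately show ?thesis by (simp add: bij_betw_def endo_inj_surj)
  qed
  have Xs: "map_pmf X B = P" if "X \<in> set Xs" for X
  proof -
    from that obtain c j where X: "X = (\<lambda>(k, \<omega>). L ((j + k) mod N) (\<omega> ! c))" and cj: "c < M" "j < N"
      by (auto simp: Xs_def)
    show ?thesis
    proof (rule pmf_eqI)
      fix a
      have eq: "map_pmf (\<lambda>\<omega>. X (k, \<omega>)) (replicate_pmf M R) = map_pmf (L ((j + k) mod N)) R" for k
      proof -
        have "map_pmf (\<lambda>\<omega>. X (k, \<omega>)) (replicate_pmf M R) =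
              map_pmf (L ((j + k) mod N)) (map_pmf (\<lambda>\<omega>. \<omega> ! c) (replicate_pmf M R))"
          by (simp add: X pmf.map_comp o_def)
        then show ?thesis using cj by (simp add: map_nth_replicate_pmf)
      qed
      have "pmf (map_pmf X B) a = (\<Sum>k<N. pmf (map_pmf (L ((j + k) mod N)) R) a) / N"
        unfolding B_def using ne by (subst pmf_map_pair) (auto simp: eq)
      \<comment> \<open>As \<open>k\<close> varies, \<open>(j + k) mod N\<close> visits each
        position exactly once, so the average no longer depends on \<open>j\<close>.\<close>
      also have "(\<Sum>k<N. pmf (map_pmf (L ((j + k) mod N)) R) a) = (\<Sum>i<N. pmf (map_pmf (L i) R) a)"
        by (rule sum.reindex_bij_betw[OF shift])
      finally show "pmf (map_pmf X B) a = pmf P a" using N by (simp add: avg)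
    qed
  qed
  let ?J = "\<lambda>z. map (\<lambda>X. X z) Xs"
  have fst_B: "map_pmf fst B = ?U" by (simp add: B_def map_fst_pair_pmf)
  have "E P [^] (N * M) \<succeq> E (map_pmf ?J B)"
    using E_joint_list[OF B _ P, of Xs] Xs by (simp add: len)
  \<comment> \<open>The shift is revealed once, at a cost \<open>E ?U\<close> that does not depend
    on \<open>M\<close>.\<close>
  then have 1: "E P [^] (N * M) \<otimes> E ?U \<succeq> E (map_pmf ?J B) \<otimes> E (map_pmf fst B)"
    unfolding fst_B by (intro geq_mult) (auto simp: E_carrier LProb_map P U B intro!: ge_refl)
  have 2: "E (map_pmf ?J B) \<otimes> E (map_pmf fst B) \<succeq> E (map_pmf (\<lambda>z. (?J z, fst z)) B)"
    by (rule E_joint[OF B])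
  \<comment> \<open>Knowing \<open>k\<close>, one can put the letters of each copy back in place,
    and \<open>det\<close> then recovers \<open>T\<close> copy by copy.\<close>
  have 3: "E (map_pmf (\<lambda>z. (?J z, fst z)) B) \<succeq> E (map_pmf (\<lambda>z. map T (snd z)) B)"
  proof (rule E_map_determined[OF B])
    fix z z' assume z: "z \<in> set_pmf B" "z' \<in> set_pmf B" "(?J z, fst z) = (?J z', fst z')"
    obtain k \<omega> \<omega>' where zk: "z = (k, \<omega>)" "z' = (k, \<omega>')" using z(3) by (cases z; cases z') auto
    have kN: "k < N" using z(1) ne by (simp add: B_def zk)
    have w: "length \<omega> = M" "set \<omega> \<subseteq> set_pmf R" "length \<omega>' = M" "set \<omega>' \<subseteq> set_pmf R"
      using z(1,2) by (auto simp: B_def zk set_replicate_pmf)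
    have "T (\<omega> ! c) = T (\<omega>' ! c)" if c: "c < M" for c
    proof (rule det)
      show "\<omega> ! c \<in> set_pmf R" "\<omega>' ! c \<in> set_pmf R" using w c by (auto simp: subset_iff)
      fix i assume i: "i < N"
      have X: "X z = X z'" if "X \<in> set Xs" for X using z(3) that by simp
      obtain j where j: "j < N" "(j + k) mod N = i"
        using shift[of k] i unfolding bij_betw_def
        by (metis (no_types, lifting) add.commute image_iff lessThan_iff)
      have "(\<lambda>(k, \<omega>). L ((j + k) mod N) (\<omega> ! c)) \<in> set Xs"
        using c j by (auto simp: Xs_def)
      from X[OF this] show "L i (\<omega> ! c) = L i (\<omega>' ! c)" using j by (simp add: zk)
    qed
    then show "map T (snd z) = map T (snd z')" using w by (auto simp: zk intro: nth_equalityI)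
  qed
  have "map_pmf (\<lambda>z. map T (snd z)) B = map_pmf (map T) (map_pmf snd B)"
    by (simp add: pmf.map_comp o_def)
  also have "\<dots> = replicate_pmf M (map_pmf T R)"
    by (simp add: B_def map_snd_pair_pmf map_replicate_pmf)
  finally have 4: "E (map_pmf (\<lambda>z. map T (snd z)) B) = E (map_pmf T R) [^] M"
    by (simp add: E_replicate LProb_map R)
  show "(E P [^] N) [^] M \<otimes> E ?U \<succeq> E (map_pmf T R) [^] M"
    using ge_trans[OF ge_trans[OF 1 2] 3] P R U B
    by (simp add: nat_pow_pow 4 E_carrier LProb_map)
qed

end

section \<open>Typical sequences\<close>

lemma expectation_pair_mult:
  fixes f :: "'a \<Rightarrow> real" and g :: "'b \<Rightarrow> real"
  assumes "finite (set_pmf P)" "finite (set_pmf Q)"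
  shows "measure_pmf.expectation (pair_pmf P Q) (\<lambda>z. f (fst z) * g (snd z)) =
    measure_pmf.expectation P f * measure_pmf.expectation Q g"
proof -
  have "measure_pmf.expectation (pair_pmf P Q) (\<lambda>z. f (fst z) * g (snd z)) =
    (\<Sum>z\<in>set_pmf P \<times> set_pmf Q. f (fst z) * g (snd z) * pmf (pair_pmf P Q) z)"
    by (rule integral_measure_pmf_real) (use assms in auto)
  also have "\<dots> = (\<Sum>x\<in>set_pmf P. f x * pmf P x) * (\<Sum>y\<in>set_pmf Q. g y * pmf Q y)"
    by (auto simp: sum_product sum.cartesian_product pmf_pair intro!: sum.cong)
  also have "\<dots> = measure_pmf.expectation P f * measure_pmf.expectation Q g"
    using assms by (simp add: integral_measure_pmf_real[of "set_pmf P"] integral_measure_pmf_real[of "set_pmf Q"])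
  finally show ?thesis .
qed

text \<open>Variances of independent centred variables add up. The cross term vanishes because
  \<open>f\<close> has mean 0; the mean of the sum is carried along in the induction.\<close>

lemma expectation_replicate_sum_sq:
  fixes f :: "'a \<Rightarrow> real"
  assumes fin: "finite (set_pmf P)" and mean: "measure_pmf.expectation P f = 0"
  shows "measure_pmf.expectation (replicate_pmf n P) (\<lambda>xs. (sum_list (map f xs))\<^sup>2) =
    real n * measure_pmf.expectation P (\<lambda>x. (f x)\<^sup>2)" (is "?B n")
proof -
  let ?S = "\<lambda>xs. sum_list (map f xs)"
  let ?A = "\<lambda>n. measure_pmf.expectation (replicate_pmf n P) ?S = 0"
  have "?A n \<and> ?B n"
  proof (induction n)
    case (Suc n)
    let ?Q = "replicate_pmf n P" and ?R = "pair_pmf P (replicate_pmf n P)"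
    have finQ: "finite (set_pmf ?Q)" and finR: "finite (set_pmf ?R)"
      using fin by (auto simp: finite_set_replicate_pmf)
    have int: "integrable (measure_pmf ?R) h" for h :: "_ \<Rightarrow> real"
      by (rule integrable_measure_pmf_finite[OF finR])
    have fst: "measure_pmf.expectation ?R (\<lambda>z. h (fst z)) = measure_pmf.expectation P h" for h :: "_ \<Rightarrow> real"
      using integral_map_pmf[of fst ?R h] by (simp add: map_fst_pair_pmf)
    have snd: "measure_pmf.expectation ?R (\<lambda>z. h (snd z)) = measure_pmf.expectation ?Q h" for h :: "_ \<Rightarrow> real"
      using integral_map_pmf[of snd ?R h] by (simp add: map_snd_pair_pmf)
    have "measure_pmf.expectation (replicate_pmf (Suc n) P) ?S =
          measure_pmf.expectation ?R (\<lambda>z. f (fst z) + ?S (snd z))"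
      unfolding replicate_pmf_Suc_conv_pair integral_map_pmf by (simp add: split_def)
    also have "\<dots> = 0" using int Suc fst[of f] snd[of ?S] mean by simp
    finally have A: "?A (Suc n)" .
    have "measure_pmf.expectation (replicate_pmf (Suc n) P) (\<lambda>xs. (?S xs)\<^sup>2) =
          measure_pmf.expectation ?R (\<lambda>z. (f (fst z))\<^sup>2 + 2 * (f (fst z) * ?S (snd z)) + (?S (snd z))\<^sup>2)"
      unfolding replicate_pmf_Suc_conv_pair integral_map_pmf
      by (simp add: split_def power2_eq_square algebra_simps)
    also have "\<dots> = measure_pmf.expectation P (\<lambda>x. (f x)\<^sup>2) + measure_pmf.expectation ?Q (\<lambda>xs. (?S xs)\<^sup>2)"
      using int fst[of "\<lambda>x. (f x)\<^sup>2"] snd[of "\<lambda>xs. (?S xs)\<^sup>2"] expectation_pair_mult[OF fin finQ, of f ?S] mean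
      by simp
    finally have "?B (Suc n)" using Suc by (simp add: algebra_simps)
    with A show ?case by blast
  qed simp
  then show ?thesis ..
qed

text \<open>Chebyshev's inequality bounds the probability by the variance of \<open>f\<close>
  divided by n \<delta>^2, which tends to 0.\<close>

lemma weak_law_of_large_numbers:
  fixes f :: "'a \<Rightarrow> real"
  assumes fin: "finite (set_pmf P)" and "\<delta> > 0" "\<epsilon> > 0"
  shows "\<forall>\<^sub>F n in sequentially.
    measure (replicate_pmf n P) {xs. sum_list (map f xs) > real n * (measure_pmf.expectation P f + \<delta>)} \<le> \<epsilon>"
proof -
  define \<mu> where "\<mu> = measure_pmf.expectation P f"
  define g where "g x = f x - \<mu>" for x
  define v where "v = measure_pmf.expectation P (\<lambda>x. (g x)\<^sup>2)"
  have g0: "measure_pmf.expectation P g = 0"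
    unfolding g_def by (simp add: integrable_measure_pmf_finite[OF fin] \<mu>_def)
  have bound: "measure (replicate_pmf n P) {xs. sum_list (map f xs) > real n * (\<mu> + \<delta>)} \<le> v / (real n * \<delta>\<^sup>2)"
    if n: "n > 0" for n
  proof -
    let ?Q = "replicate_pmf n P" and ?S = "\<lambda>xs. sum_list (map g xs)"
    let ?A = "{xs. sum_list (map f xs) > real n * (\<mu> + \<delta>)}"
    have int: "integrable (measure_pmf ?Q) h" for h :: "_ \<Rightarrow> real"
      by (rule integrable_measure_pmf_finite) (simp add: fin finite_set_replicate_pmf)
    have S: "?S xs = sum_list (map f xs) - real (length xs) * \<mu>" for xs
      by (induction xs) (auto simp: g_def algebra_simps)
    have "measure ?Q ?A = measure_pmf.expectation ?Q (indicator ?A)" by simp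
    also have "\<dots> \<le> measure_pmf.expectation ?Q (\<lambda>xs. (?S xs)\<^sup>2 / (real n * \<delta>)\<^sup>2)"
    proof (intro integral_mono_AE int AE_pmfI)
      fix xs assume "xs \<in> set_pmf ?Q"
      then have l: "length xs = n" by (simp add: set_replicate_pmf)
      show "indicator ?A xs \<le> (?S xs)\<^sup>2 / (real n * \<delta>)\<^sup>2"
      proof (cases "xs \<in> ?A")
        case True
        then have "real n * \<delta> \<le> ?S xs" by (simp add: S l algebra_simps)
        then have "(real n * \<delta>)\<^sup>2 \<le> (?S xs)\<^sup>2" using \<open>\<delta> > 0\<close> by (intro power_mono) auto
        then show ?thesis using True n \<open>\<delta> > 0\<close> by simp
      qed simp
    qed
    also have "\<dots> = v / (real n * \<delta>\<^sup>2)"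
      using n \<open>\<delta> > 0\<close> expectation_replicate_sum_sq[OF fin g0, of n]
      by (simp add: v_def power2_eq_square)
    finally show ?thesis .
  qed
  have "(\<lambda>n. v / (real n * \<delta>\<^sup>2)) \<longlonglongrightarrow> 0"
    using \<open>\<delta> > 0\<close> by real_asymp
  then have "\<forall>\<^sub>F n in sequentially. v / (real n * \<delta>\<^sup>2) < \<epsilon>"
    using \<open>\<epsilon> > 0\<close> by (rule order_tendstoD)
  then show ?thesis using eventually_gt_at_top[of 0]
    by eventually_elim (use bound[unfolded \<mu>_def] in \<open>meson less_imp_le order_trans\<close>)
qed

text \<open>The product of the letter probabilities is written as the exponential of a sum, to which
  the law of large numbers applies.\<close>

lemma pmf_replicate_pmf:
  assumes "xs \<in> set_pmf (replicate_pmf n P)"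
  shows "pmf (replicate_pmf n P) xs = exp (sum_list (map (\<lambda>x. ln (pmf P x)) xs))"
  using assms
proof (induction n arbitrary: xs)
  case (Suc n)
  then obtain x ys where xs: "xs = x # ys" and x: "x \<in> set_pmf P" and ys: "ys \<in> set_pmf (replicate_pmf n P)"
    by auto
  have "pmf (replicate_pmf (Suc n) P) xs = pmf (pair_pmf P (replicate_pmf n P)) (x, ys)"
    unfolding replicate_pmf_Suc_conv_pair xs
    using pmf_map_inj'[of "\<lambda>(x, xs). x # xs" "pair_pmf P (replicate_pmf n P)" "(x, ys)"]
    by (simp add: inj_def)
  then show ?case using Suc.IH[OF ys] x by (simp add: pmf_pair xs exp_add pmf_positive)
qed simp

lemma sum_list_indicator_eq_count: "sum_list (map (indicator {a} :: 'a \<Rightarrow> real) xs) = count_list xs a"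
  by (induction xs) auto

text \<open>Asymptotic equipartition: up to a small \<gamma> in the exponent, \<open>Q\<close> has
  at most exp(n \<open>H1 Q\<close>) typical sequences and \<open>P\<close> at least exp(n
  \<open>H1 P\<close>)/2, even when the letter counts are also required to be near their means or
  below. For large n the former inject into the latter.\<close>

lemma typical_embedding:
  fixes P :: "'a pmf" and Q :: "'b pmf"
  assumes finP: "finite (set_pmf P)" and finQ: "finite (set_pmf Q)" and less: "H1 Q < H1 P" and "\<delta> > 0"
  shows "\<forall>\<^sub>F n in sequentially. \<exists>T g. T \<subseteq> set_pmf (replicate_pmf n Q) \<and>
    measure (replicate_pmf n Q) (- T) \<le> \<delta> \<and> inj_on g T \<and>
    (\<forall>z\<in>T. g z \<in> set_pmf (replicate_pmf n P) \<and>
      (\<forall>a\<in>set_pmf P. real (count_list (g z) a) \<le> real n * (pmf P a + \<delta>)))"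
proof -
  define \<gamma> where "\<gamma> = (H1 P - H1 Q) / 4"
  have \<gamma>: "\<gamma> > 0" using less by (simp add: \<gamma>_def)
  \<comment> \<open>With \<open>c\<close> as bound for each of the
    \<open>card (set_pmf P) + 1\<close> exceptional events, their union has probability at most
    1/2.\<close>
  define c where "c = 1 / (2 * (real (card (set_pmf P)) + 1))"
  have c: "c > 0" by (simp add: c_def)
  have HP: "measure_pmf.expectation P (\<lambda>x. ln (pmf P x)) = - H1 P"
    and HQ: "measure_pmf.expectation Q (\<lambda>x. - ln (pmf Q x)) = H1 Q"
    using finP finQ by (simp_all add: H1_eq_expectation fin_H1_finite)
  have ind: "measure_pmf.expectation P (indicator {a}) = pmf P a" for a
    by (simp add: measure_pmf_single)
  have "\<forall>\<^sub>F n in sequentially. measure (replicate_pmf n Q) {zs. sum_list (map (\<lambda>x. - ln (pmf Q x)) zs) > real n * (H1 Q + \<gamma>)} \<le> \<delta>"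
    using weak_law_of_large_numbers[OF finQ \<gamma> \<open>\<delta> > 0\<close>, of "\<lambda>x. - ln (pmf Q x)"] by (simp only: HQ)
  moreover have "\<forall>\<^sub>F n in sequentially. measure (replicate_pmf n P) {xs. sum_list (map (\<lambda>x. ln (pmf P x)) xs) > real n * (- H1 P + \<gamma>)} \<le> c"
    using weak_law_of_large_numbers[OF finP \<gamma> c, of "\<lambda>x. ln (pmf P x)"] by (simp only: HP)
  moreover have "\<forall>\<^sub>F n in sequentially. \<forall>a\<in>set_pmf P. measure (replicate_pmf n P) {xs. real (count_list xs a) > real n * (pmf P a + \<delta>)} \<le> c"
    using weak_law_of_large_numbers[OF finP \<open>\<delta> > 0\<close> c, of "indicator {_}"]
    by (intro eventually_ball_finite finP ballI) (simp only: ind sum_list_indicator_eq_count)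
  \<comment> \<open>The exponents differ by \<open>2 * \<gamma>\<close> per letter, which eventually
    outweighs the factor 1/2.\<close>
  moreover have "\<forall>\<^sub>F n in sequentially. exp (real n * (H1 Q + \<gamma>)) \<le> exp (real n * (H1 P - \<gamma>)) / 2"
  proof -
    have "\<forall>\<^sub>F n in sequentially. real n \<ge> ln 2 / (2 * \<gamma>)"
      by (rule eventually_compose_filterlim[OF eventually_ge_at_top filterlim_real_sequentially])
    then show ?thesis
    proof eventually_elim
      case (elim n)
      then have "ln 2 \<le> real n * (2 * \<gamma>)" using \<gamma> by (simp add: pos_divide_le_eq)
      also have "\<dots> = real n * (H1 P - \<gamma>) - real n * (H1 Q + \<gamma>)"
        by (simp add: \<gamma>_def field_simps)
      finally have "exp (real n * (H1 Q + \<gamma>) + ln 2) \<le> exp (real n * (H1 P - \<gamma>))" by simp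
      then show ?case by (simp add: exp_add)
    qed
  qed
  ultimately show ?thesis
  proof eventually_elim
    case (elim n)
    let ?Q = "replicate_pmf n Q" and ?P = "replicate_pmf n P"
    let ?ZQ = "{zs. sum_list (map (\<lambda>x. - ln (pmf Q x)) zs) > real n * (H1 Q + \<gamma>)}"
    let ?ZP = "{xs. sum_list (map (\<lambda>x. ln (pmf P x)) xs) > real n * (- H1 P + \<gamma>)}"
    let ?C = "\<lambda>a. {xs. real (count_list xs a) > real n * (pmf P a + \<delta>)}"
    define T where "T = set_pmf ?Q - ?ZQ"
    define S where "S = set_pmf ?P - (?ZP \<union> (\<Union>a\<in>set_pmf P. ?C a))"
    have finT: "finite T" and finS: "finite S"
      using finP finQ by (auto simp: T_def S_def finite_set_replicate_pmf)
    \<comment> \<open>The members of \<open>T\<close> are not too improbable and their total mass is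
      at most 1, so there are few of them.\<close>
    have "real (card T) * exp (- (real n * (H1 Q + \<gamma>))) \<le> (\<Sum>z\<in>T. pmf ?Q z)"
    proof (rule sum_bounded_below)
      fix z assume "z \<in> T"
      then have "z \<in> set_pmf ?Q" "- sum_list (map (\<lambda>x. ln (pmf Q x)) z) \<le> real n * (H1 Q + \<gamma>)"
        by (auto simp: T_def uminus_sum_list_map o_def)
      then show "exp (- (real n * (H1 Q + \<gamma>))) \<le> pmf ?Q z"
        by (simp add: pmf_replicate_pmf)
    qed
    also have "\<dots> \<le> 1" using finT by (simp flip: measure_measure_pmf_finite)
    finally have cT: "real (card T) \<le> exp (real n * (H1 Q + \<gamma>))"
      by (simp only: exp_minus divide_inverse[symmetric] pos_divide_le_eq[OF exp_gt_zero] mult_1)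
    have "measure ?P (?ZP \<union> (\<Union>a\<in>set_pmf P. ?C a)) \<le> measure ?P ?ZP + (\<Sum>a\<in>set_pmf P. measure ?P (?C a))"
      by (rule order_trans[OF measure_Un_le add_left_mono[OF measure_UNION_le]]) (auto simp: finP)
    also have "\<dots> \<le> c + real (card (set_pmf P)) * c"
      using elim(2,3) by (intro add_mono sum_bounded_above) auto
    also have "\<dots> = 1 / 2" by (simp add: c_def field_simps)
    finally have "1 / 2 \<le> measure ?P (- (?ZP \<union> (\<Union>a\<in>set_pmf P. ?C a)))"
      by (subst Compl_eq_Diff_UNIV, subst measure_pmf.prob_compl[of _ ?P, simplified]) auto
    also have "\<dots> = measure ?P S"
      by (rule measure_eq_AE) (auto intro!: AE_pmfI simp: S_def)
    also have "\<dots> = (\<Sum>x\<in>S. pmf ?P x)" using finS by (simp add: measure_measure_pmf_finite)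
    \<comment> \<open>Conversely \<open>S\<close> has mass at least 1/2 made up of small
      probabilities, so it has many members.\<close>
    also have "\<dots> \<le> real (card S) * exp (- (real n * (H1 P - \<gamma>)))"
    proof (rule sum_bounded_above)
      fix x assume "x \<in> S"
      then have "x \<in> set_pmf ?P" "sum_list (map (\<lambda>x. ln (pmf P x)) x) \<le> real n * (- H1 P + \<gamma>)"
        by (auto simp: S_def)
      then show "pmf ?P x \<le> exp (- (real n * (H1 P - \<gamma>)))"
        by (simp add: pmf_replicate_pmf algebra_simps)
    qed
    finally have "1 / 2 * exp (real n * (H1 P - \<gamma>)) \<le> real (card S)"
      by (simp only: exp_minus divide_inverse[symmetric] pos_le_divide_eq[OF exp_gt_zero])
    then have "card T \<le> card S" using cT elim(4) by simp
    then obtain g where g: "g ` T \<subseteq> S" "inj_on g T" using card_le_inj[OF finT finS] by blast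
    have "measure ?Q (- T) = measure ?Q ?ZQ"
      by (rule measure_eq_AE) (auto intro!: AE_pmfI simp: T_def)
    then have "measure ?Q (- T) \<le> \<delta>" using elim(1) by simp
    moreover have "g z \<in> set_pmf ?P" "\<forall>a\<in>set_pmf P. real (count_list (g z) a) \<le> real n * (pmf P a + \<delta>)"
      if "z \<in> T" for z
      using g(1) that unfolding S_def by (auto simp: not_less image_subset_iff)
    ultimately show ?case using g(2) by (intro exI[of _ T] exI[of _ g]) (auto simp: T_def)
  qed
qed

section \<open>Comparison of finite distributions\<close>

lemma exists_distinct_of_H1_pos:
  assumes "H1 P \<noteq> 0" obtains a b where "a \<in> set_pmf P" "b \<in> set_pmf P" "a \<noteq> b"
proof (rule ccontr)
  assume "\<not> thesis"
  obtain a where "a \<in> set_pmf P" using set_pmf_not_empty[of P] by blast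
  then have "set_pmf P \<subseteq> {a}" using that \<open>\<not> thesis\<close> by blast
  then have "P = return_pmf a" by (simp add: set_pmf_subset_singleton)
  then show False using assms by simp
qed

text \<open>The count is the sum over positions of the indicators of \<open>a\<close>, and
  expectation is linear.\<close>

lemma sum_pmf_nth_eq_expectation_count:
  assumes "finite (set_pmf Z)" "\<And>z. z \<in> set_pmf Z \<Longrightarrow> length (G z) = n"
  shows "(\<Sum>i<n. pmf (map_pmf (\<lambda>z. G z ! i) Z) a) = measure_pmf.expectation Z (\<lambda>z. real (count_list (G z) a))"
proof -
  have int: "integrable (measure_pmf Z) h" for h :: "_ \<Rightarrow> real"
    by (rule integrable_measure_pmf_finite[OF assms(1)])
  have "pmf (map_pmf (\<lambda>z. G z ! i) Z) a = measure_pmf.expectation Z (\<lambda>z. indicator {a} (G z ! i))" for i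
    using integral_map_pmf[of "\<lambda>z. G z ! i" Z "indicator {a} :: _ \<Rightarrow> real"] by (simp add: measure_pmf_single)
  then have "(\<Sum>i<n. pmf (map_pmf (\<lambda>z. G z ! i) Z) a) =
      measure_pmf.expectation Z (\<lambda>z. \<Sum>i<n. indicator {a} (G z ! i))"
    by (simp add: int)
  also have "\<dots> = measure_pmf.expectation Z (\<lambda>z. real (count_list (G z) a))"
  proof (intro integral_cong_AE AE_pmfI)
    fix z assume "z \<in> set_pmf Z"
    then show "(\<Sum>i<n. indicator {a} (G z ! i)) = real (count_list (G z) a)"
      using assms(2)[of z] sum_list_indicator_eq_count[of a "G z"]
      by (simp add: sum_list_sum_nth atLeast0LessThan)
  qed auto
  finally show ?thesis .
qed

context entropy
begin

text \<open>A typical sequence \<open>z\<close> of \<open>Q\<close> is encoded by the letter \<open>a0\<close> followed by a sequence that is typical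
  for \<open>P\<close>, an atypical one by \<open>a1\<close> followed by an arbitrary sequence. The average law of these letters
  is close to \<open>P\<close>, and \<open>m\<close> further letters, all equal to one independent letter of law \<open>K\<close>, make
  it equal to \<open>P\<close>.\<close>

lemma E_ge_finite_less:
  fixes P :: "'a pmf" and Q :: "'b pmf"
  assumes finP: "finite (set_pmf P)" and finQ: "finite (set_pmf Q)"
    and card: "card (set_pmf Q) \<le> card (set_pmf P)" and less: "H1 Q < H1 P"
  shows "E P \<succeq> E Q"
proof (rule ge_of_pow_mult)
  have P: "P \<in> LProb \<rho>" and Q: "Q \<in> LProb \<rho>" using finP finQ by (auto simp: FinProb_imp_LProb)
  show "E P \<in> carrier W" "E Q \<in> carrier W" "E P [^] (2::nat) \<in> carrier W" using P Q by (auto simp: E_carrier)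
  let ?A = "set_pmf P"
  have "H1 P \<noteq> 0" using less H1_nonneg[OF fin_H1_finite[OF finQ]] by simp
  then obtain a0 a1 where a01: "a0 \<in> ?A" "a1 \<in> ?A" "a0 \<noteq> a1" by (rule exists_distinct_of_H1_pos)
  define p where "p = Min (pmf P ` ?A)"
  have p_le: "p \<le> pmf P a" if "a \<in> ?A" for a using that finP by (simp add: p_def)
  have p: "0 < p" unfolding p_def using finP by (subst Min_gr_iff) (auto simp: pmf_positive set_pmf_not_empty)
  have p1: "p \<le> 1" using p_le[OF a01(1)] pmf_le_1[of P a0] by linarith
  fix r :: nat assume r: "r \<ge> 1"
  \<comment> \<open>Chosen so that \<open>n * \<delta>\<close> equals \<open>m * p / 4\<close> for
    the \<open>n\<close> and \<open>m\<close> below, an error that \<open>m\<close> further letters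
    can correct.\<close>
  define \<delta> where "\<delta> = p / (4 * real r)"
  have \<delta>: "\<delta> > 0" using p r by (simp add: \<delta>_def)
  have \<delta>1: "\<delta> \<le> 1" using p1 r p by (simp add: \<delta>_def field_simps)
  obtain n0 where n0: "\<And>n. n \<ge> n0 \<Longrightarrow> \<exists>T g. T \<subseteq> set_pmf (replicate_pmf n Q) \<and>
    measure (replicate_pmf n Q) (- T) \<le> \<delta> \<and> inj_on g T \<and>
    (\<forall>z\<in>T. g z \<in> set_pmf (replicate_pmf n P) \<and>
      (\<forall>a\<in>?A. real (count_list (g z) a) \<le> real n * (pmf P a + \<delta>)))"
    using typical_embedding[OF finP finQ less \<delta>] unfolding eventually_sequentially by blast
  \<comment> \<open>The bound \<open>n0\<close> makes the typical embedding available, and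
    \<open>4 / p\<close> gives \<open>m * p\<close> \<ge> 4, which takes care of the bounded
    errors.\<close>
  define m where "m = max (max 1 n0) (nat \<lceil>4 / p\<rceil>)"
  define n where "n = r * m"
  have m1: "m \<ge> 1" and "n0 \<le> m" by (simp_all add: m_def)
  moreover have "m \<le> n" using r by (simp add: n_def)
  ultimately have mn0: "n \<ge> n0" by simp
  have "4 / p \<le> real m" by (simp add: m_def) linarith
  then have mp: "4 \<le> real m * p" using p by (simp add: pos_divide_le_eq)
  let ?Q = "replicate_pmf n Q" and ?P = "replicate_pmf n P"
  obtain T g where T: "T \<subseteq> set_pmf ?Q" "measure ?Q (- T) \<le> \<delta>" "inj_on g T"
    and g: "\<And>z. z \<in> T \<Longrightarrow> g z \<in> set_pmf ?P"
      "\<And>z a. z \<in> T \<Longrightarrow> a \<in> ?A \<Longrightarrow> real (count_list (g z) a) \<le> real n * (pmf P a + \<delta>)"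
    using n0[OF mn0] by blast
  have finQn: "finite (set_pmf ?Q)" and finPn: "finite (set_pmf ?P)"
    using finP finQ by (auto simp: finite_set_replicate_pmf)
  have "card (set_pmf ?Q) \<le> card (set_pmf ?P)"
    using finP finQ card by (simp add: card_set_replicate_pmf power_mono)
  then obtain j where j: "j ` set_pmf ?Q \<subseteq> set_pmf ?P" "inj_on j (set_pmf ?Q)"
    using card_le_inj[OF finQn finPn] by blast
  \<comment> \<open>The first letter tells the branches apart, so \<open>G\<close> is injective even
    if the ranges of \<open>g\<close> and \<open>j\<close> overlap.\<close>
  define G where "G z = (if z \<in> T then a0 # g z else a1 # j z)" for z
  have G: "length (G z) = n + 1" "set (G z) \<subseteq> ?A" if "z \<in> set_pmf ?Q" for z
  proof -
    have "g z \<in> set_pmf ?P" if "z \<in> T" using g that by simp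
    moreover have "j z \<in> set_pmf ?P" using j that by auto
    ultimately show "length (G z) = n + 1" "set (G z) \<subseteq> ?A"
      using a01 by (auto simp: G_def set_replicate_pmf)
  qed
  have G_inj: "inj_on G (set_pmf ?Q)"
    using T j a01 unfolding G_def inj_on_def by (auto split: if_splits)
  have len: "length (g z) = n" if "z \<in> T" for z using g(1)[OF that] by (simp add: set_replicate_pmf)
  define law where "law i = map_pmf (\<lambda>z. G z ! i) ?Q" for i
  have law_set: "set_pmf (law i) \<subseteq> ?A" if "i < n + 1" for i
    using G that by (force simp: law_def)
  define \<mu> where "\<mu> a = (\<Sum>i<n+1. pmf (law i) a)" for a
  have \<mu>_le: "\<mu> a \<le> real n * (pmf P a + \<delta>) + 1 + real (n + 1) * \<delta>" if a: "a \<in> ?A" for a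
  proof -
    have int: "integrable (measure_pmf ?Q) h" for h :: "_ \<Rightarrow> real"
      by (rule integrable_measure_pmf_finite[OF finQn])
    have "\<mu> a = measure_pmf.expectation ?Q (\<lambda>z. real (count_list (G z) a))"
      unfolding \<mu>_def law_def by (rule sum_pmf_nth_eq_expectation_count[OF finQn G(1)])
    also have "\<dots> \<le> measure_pmf.expectation ?Q (\<lambda>z. real n * (pmf P a + \<delta>) + 1 + real (n + 1) * indicator (- T) z)"
    proof (intro integral_mono_AE int AE_pmfI)
      fix z assume z: "z \<in> set_pmf ?Q"
      show "real (count_list (G z) a) \<le> real n * (pmf P a + \<delta>) + 1 + real (n + 1) * indicator (- T) z"
      proof (cases "z \<in> T")
        case True
        then show ?thesis using g(2)[OF True a] by (simp add: G_def)
      next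
        case False
        have "real (count_list (G z) a) \<le> real (n + 1)"
          using count_le_length[of "G z" a] G(1)[OF z] by simp
        moreover have "0 \<le> real n * (pmf P a + \<delta>)" using \<delta> by simp
        ultimately show ?thesis using False by simp
      qed
    qed
    also have "\<dots> = real n * (pmf P a + \<delta>) + 1 + real (n + 1) * measure ?Q (- T)"
      by (simp add: int)
    also have "\<dots> \<le> real n * (pmf P a + \<delta>) + 1 + real (n + 1) * \<delta>"
      using T(2) by (intro add_left_mono mult_left_mono) auto
    finally show ?thesis .
  qed
  have \<mu>_out: "\<mu> a = 0" if "a \<notin> ?A" for a
    unfolding \<mu>_def using law_set that by (intro sum.neutral) (auto simp: pmf_eq_0_set_pmf subset_iff)
  \<comment> \<open>The mass of \<open>a\<close> still missing from the total
    \<open>(n + 1 + m) * pmf P a\<close>, shared equally among \<open>m\<close> letters.\<close>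
  define k where "k a = (real (n + 1 + m) * pmf P a - \<mu> a) / real m" for a
  have k_nonneg: "0 \<le> k a" for a
  proof (cases "a \<in> ?A")
    case True
    \<comment> \<open>By \<open>\<mu>_le\<close> the excess of \<open>\<mu> a\<close> over
      \<open>n * pmf P a\<close> is at most \<open>m * p / 2 + 2\<close>, hence at most
      \<open>m * p\<close> since \<open>m * p\<close> \<ge> 4.\<close>
    have "real n * \<delta> = real m * p / 4" using r by (simp add: n_def \<delta>_def)
    moreover have "real (1 + m) * p \<le> real (1 + m) * pmf P a" using p_le[OF True] by (intro mult_left_mono) auto
    ultimately have "\<mu> a \<le> real (n + 1 + m) * pmf P a"
      using \<mu>_le[OF True] mp \<delta>1 p by (simp add: algebra_simps)
    then show ?thesis by (simp add: k_def)
  next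
    case False
    then show ?thesis by (simp add: k_def \<mu>_out)
  qed
  have "(\<Sum>a\<in>?A. \<mu> a) = (\<Sum>i<n+1. \<Sum>a\<in>?A. pmf (law i) a)"
    unfolding \<mu>_def by (rule sum.swap)
  also have "\<dots> = (\<Sum>i<n+1. 1)"
    using law_set finP by (intro sum.cong refl sum_pmf_eq_1) auto
  finally have sum_\<mu>: "(\<Sum>a\<in>?A. \<mu> a) = real (n + 1)" by simp
  have "(\<Sum>a\<in>?A. k a) = (real (n + 1 + m) * (\<Sum>a\<in>?A. pmf P a) - (\<Sum>a\<in>?A. \<mu> a)) / real m"
    by (simp add: k_def sum_divide_distrib[symmetric] sum_subtractf sum_distrib_left)
  also have "\<dots> = 1" using m1 finP by (simp add: sum_\<mu> sum_pmf_eq_1)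
  finally have sum_k: "(\<Sum>a\<in>?A. k a) = 1" .
  have "(\<integral>\<^sup>+a. ennreal (k a) \<partial>count_space UNIV) = (\<Sum>a\<in>?A. ennreal (k a))"
    by (rule nn_integral_count_space') (use finP in \<open>auto simp: k_def \<mu>_out set_pmf_iff\<close>)
  also have "\<dots> = 1" by (simp add: sum_ennreal k_nonneg sum_k)
  finally have pmf_K: "pmf (embed_pmf k) a = k a" for a
    using k_nonneg by (intro pmf_embed_pmf) auto
  define K where "K = embed_pmf k"
  have "pmf K a = 0" if "a \<notin> ?A" for a
    using that by (simp add: K_def pmf_K k_def \<mu>_out pmf_eq_0_set_pmf)
  then have finK: "finite (set_pmf K)"
    by (intro finite_subset[OF _ finP]) (auto simp: pmf_eq_0_set_pmf)
  define R where "R = pair_pmf ?Q K"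
  define L where "L i = (\<lambda>(z, v). if i < n + 1 then G z ! i else v)" for i
  define N where "N = n + 1 + m"
  have R: "R \<in> LProb \<rho>" unfolding R_def by (intro LProb_pair LProb_replicate Q FinProb_imp_LProb finK)
  have fst_R: "map_pmf fst R = ?Q" and snd_R: "map_pmf snd R = K"
    by (simp_all add: R_def map_fst_pair_pmf map_snd_pair_pmf)
  have "E P [^] N \<succeq> E (map_pmf fst R)"
  proof (rule E_average_law[OF R P])
    show "N \<ge> 1" by (simp add: N_def)
    fix a
    have L1: "map_pmf (L i) R = law i" if "i < n + 1" for i
    proof -
      have "map_pmf (L i) R = map_pmf (\<lambda>z. G z ! i) (map_pmf fst R)"
        using that by (simp add: L_def pmf.map_comp o_def split_def)
      then show ?thesis by (simp add: fst_R law_def)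
    qed
    have L2: "map_pmf (L i) R = K" if "\<not> i < n + 1" for i
    proof -
      have "L i = snd" using that by (auto simp: L_def)
      then show ?thesis by (simp add: snd_R)
    qed
    have "(\<Sum>i<N. pmf (map_pmf (L i) R) a) =
        (\<Sum>i<n+1. pmf (map_pmf (L i) R) a) + (\<Sum>i=n+1..<N. pmf (map_pmf (L i) R) a)"
      using sum.atLeastLessThan_concat[of 0 "n + 1" N "\<lambda>i. pmf (map_pmf (L i) R) a"]
      by (simp only: lessThan_atLeast0 N_def)
    also have "(\<Sum>i<n+1. pmf (map_pmf (L i) R) a) = \<mu> a"
      unfolding \<mu>_def by (rule sum.cong) (simp_all add: L1)
    also have "(\<Sum>i=n+1..<N. pmf (map_pmf (L i) R) a) = real m * k a"
      by (simp add: L2 N_def K_def pmf_K)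
    also have "\<mu> a + real m * k a = real N * pmf P a" using m1 by (simp add: k_def N_def)
    finally show "(\<Sum>i<N. pmf (map_pmf (L i) R) a) = real N * pmf P a" .
  next
    fix \<omega> \<omega>' assume w: "\<omega> \<in> set_pmf R" "\<omega>' \<in> set_pmf R" and L: "\<And>i. i < N \<Longrightarrow> L i \<omega> = L i \<omega>'"
    have z: "fst \<omega> \<in> set_pmf ?Q" "fst \<omega>' \<in> set_pmf ?Q" using w by (auto simp: R_def)
    have "G (fst \<omega>) = G (fst \<omega>')"
    proof (rule nth_equalityI)
      show "length (G (fst \<omega>)) = length (G (fst \<omega>'))" using G z by simp
      fix i assume "i < length (G (fst \<omega>))"
      then show "G (fst \<omega>) ! i = G (fst \<omega>') ! i"
        using L[of i] G(1)[OF z(1)] by (auto simp: L_def N_def split_def)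
    qed
    then show "fst \<omega> = fst \<omega>'" using G_inj z by (auto dest: inj_onD)
  qed
  then have 1: "E P [^] N \<succeq> E Q [^] n" by (simp add: fst_R E_replicate Q)
  \<comment> \<open>The overhead \<open>1 + m\<close> is at most \<open>2 * m\<close>, so with
    \<open>n = r * m\<close> the common exponent \<open>m\<close> can be cancelled and leaves
    exponents \<open>r + 2\<close> and \<open>r\<close>.\<close>
  have "N \<le> (r + 2) * m" using m1 by (simp add: N_def n_def algebra_simps)
  then have "E P [^] ((r + 2) * m) \<succeq> E P [^] N"
    by (intro pow_mono E_carrier E_nonneg P)
  from ge_trans[OF this 1] have pow: "(E P [^] (r + 2)) [^] m \<succeq> (E Q [^] r) [^] m"
    using P Q by (simp only: nat_pow_pow E_carrier n_def nat_pow_closed)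
  have "E P [^] (r + 2) \<succeq> E Q [^] r"
    by (rule ge_of_pow[OF _ _ _ _ m1 pow]) (intro pow_nonneg E_nonneg E_carrier nat_pow_closed P Q)+
  then show "E P [^] r \<otimes> E P [^] (2::nat) \<succeq> E Q [^] r"
    using P by (simp add: nat_pow_mult E_carrier)
qed

text \<open>One fair bit makes the inequality between the entropies of n-th powers strict, at a cost
  independent of n.\<close>

lemma E_ge_finite:
  fixes P :: "'a pmf" and Q :: "'b pmf"
  assumes finP: "finite (set_pmf P)" and finQ: "finite (set_pmf Q)"
    and card: "card (set_pmf Q) \<le> card (set_pmf P)" and le: "H1 Q \<le> H1 P"
  shows "E P \<succeq> E Q"
proof (rule ge_of_pow_mult)
  let ?B = "pmf_of_set (UNIV :: bool set)"
  have P: "P \<in> LProb \<rho>" and Q: "Q \<in> LProb \<rho>" and B: "?B \<in> LProb \<rho>"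
    using finP finQ by (auto simp: FinProb_imp_LProb)
  show "E P \<in> carrier W" "E Q \<in> carrier W" "E ?B \<in> carrier W" using P Q B by (auto simp: E_carrier)
  fix n :: nat
  have "E (pair_pmf (replicate_pmf n P) ?B) \<succeq> E (replicate_pmf n Q)"
  proof (rule E_ge_finite_less)
    show "finite (set_pmf (pair_pmf (replicate_pmf n P) ?B))" "finite (set_pmf (replicate_pmf n Q))"
      using finP finQ by (auto simp: finite_set_replicate_pmf)
    have "card (set_pmf Q) ^ n \<le> card (set_pmf P) ^ n" using card by (rule power_mono) simp
    then show "card (set_pmf (replicate_pmf n Q)) \<le> card (set_pmf (pair_pmf (replicate_pmf n P) ?B))"
      using finP finQ by (simp add: card_set_replicate_pmf card_cartesian_product)
    have "H1 ?B = ln 2" by (subst H1_pmf_of_set) auto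
    moreover have "real n * H1 Q \<le> real n * H1 P" using le by (rule mult_left_mono) simp
    then have "real n * H1 Q < real n * H1 P + ln 2" using ln_gt_zero[of "2 :: real"] by linarith
    ultimately show "H1 (replicate_pmf n Q) < H1 (pair_pmf (replicate_pmf n P) ?B)"
      using finP finQ by (simp add: H1_pair H1_replicate fin_H1_finite fin_H1_replicate)
  qed
  then show "E P [^] n \<otimes> E ?B \<succeq> E Q [^] n"
    using P Q B by (simp add: E_pair E_replicate LProb_replicate)
qed

end

section \<open>Infinite distributions\<close>

text \<open>A coarsening with finite range for finite \<open>F\<close>; \<open>reveal F\<close> and
  \<open>reveal (- F)\<close> together determine the point.\<close>

definition reveal :: "'a set \<Rightarrow> 'a \<Rightarrow> 'a option" where
  "reveal F x = (if x \<in> F then Some x else None)"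

lemma pmf_map_reveal: "pmf (map_pmf (reveal F) P) (Some x) = (if x \<in> F then pmf P x else 0)"
proof -
  have "reveal F -` {Some x} = (if x \<in> F then {x} else {})" by (auto simp: reveal_def split: if_splits)
  then show ?thesis by (simp add: pmf_map measure_pmf_single)
qed

lemma finite_set_pmf_reveal: "finite F \<Longrightarrow> finite (set_pmf (map_pmf (reveal F) P))"
  by (rule finite_subset[of _ "insert None (Some ` F)"]) (auto simp: reveal_def)

lemma mult_ln_pmf_nonpos: "pmf P x * ln (pmf P x) \<le> 0"
  by (simp add: mult_nonneg_nonpos ln_pmf_nonpos)

lemma sum_le_H1:
  assumes "finite (set_pmf P)" "finite G"
  shows "- (\<Sum>x\<in>G. pmf P x * ln (pmf P x)) \<le> H1 P"
proof -
  have "(\<Sum>x\<in>G. - (pmf P x * ln (pmf P x))) = (\<Sum>x\<in>G \<inter> set_pmf P. - (pmf P x * ln (pmf P x)))"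
    by (rule sum.mono_neutral_right) (use assms in \<open>auto simp: set_pmf_iff\<close>)
  also have "\<dots> \<le> (\<Sum>x\<in>set_pmf P. - (pmf P x * ln (pmf P x)))"
    by (rule sum_mono2) (use assms mult_ln_pmf_nonpos in auto)
  finally show ?thesis using assms by (simp add: H1_finite sum_negf)
qed

text \<open>The terms of the entropy series are nonnegative, so some finite partial sum exceeds
  \<open>c\<close>. Revealing its points preserves these terms, and \<open>None\<close> can only add
  to them.\<close>

lemma exists_reveal_H1_greater:
  assumes P: "fin_H1 P" and c: "c < H1 P"
  obtains F where "finite F" "c < H1 (map_pmf (reveal F) P)"
proof -
  have "(\<lambda>x. pmf P x * \<bar>ln (pmf P x)\<bar>) summable_on set_pmf P"
    using P by (simp add: fin_H1_def integrable_measure_pmf_iff_summable)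
  then have sm: "(\<lambda>x. - (pmf P x * ln (pmf P x))) summable_on set_pmf P"
    by (simp add: abs_of_nonpos ln_pmf_nonpos)
  have "\<exists>F. finite F \<and> F \<subseteq> set_pmf P \<and> c < (\<Sum>x\<in>F. - (pmf P x * ln (pmf P x)))"
  proof (rule ccontr)
    assume "\<not> ?thesis"
    then have "(\<Sum>\<^sub>\<infinity>x\<in>set_pmf P. - (pmf P x * ln (pmf P x))) \<le> c"
      by (intro infsum_le_finite_sums[OF sm]) (meson not_le)
    then show False using c by (simp add: H1_def infsum_uminus)
  qed
  then obtain F where F: "finite F" "c < (\<Sum>x\<in>F. - (pmf P x * ln (pmf P x)))" by blast
  let ?T = "map_pmf (reveal F) P"
  have "(\<Sum>x\<in>F. - (pmf P x * ln (pmf P x))) = - (\<Sum>y\<in>Some ` F. pmf ?T y * ln (pmf ?T y))"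
    by (simp add: sum.reindex pmf_map_reveal sum_negf)
  also have "\<dots> \<le> H1 ?T"
    by (rule sum_le_H1) (use F finite_set_pmf_reveal in blast)+
  finally show thesis using that F by force
qed

section \<open>Dyadic mixtures and tails\<close>

lemma summable_geometric_half: "0 < \<rho> \<Longrightarrow> summable (\<lambda>n. ((1/2 :: real) ^ Suc n) powr \<rho>)"
proof -
  assume "0 < \<rho>"
  have "(x ^ k) powr \<rho> = (x powr \<rho>) ^ k" if "x > 0" for x :: real and k
    using that by (simp add: powr_powr mult.commute flip: powr_realpow)
  then have "((1/2 :: real) ^ Suc n) powr \<rho> = ((1/2) powr \<rho>) ^ Suc n" for n
    by (simp del: power_Suc)
  moreover have "(1/2 :: real) powr \<rho> < 1" using \<open>0 < \<rho>\<close> by (simp add: powr_divide gr_one_powr)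
  then have "summable (\<lambda>n. ((1/2 :: real) powr \<rho>) ^ Suc n)"
    by (intro summable_ignore_initial_segment[of _ 1, simplified] summable_geometric) simp
  ultimately show ?thesis by simp
qed

lemma LProb_geometric: "0 < \<rho> \<Longrightarrow> geometric_pmf (1/2) \<in> LProb \<rho>"
proof -
  assume "0 < \<rho>"
  then have "(\<lambda>n. ((1/2 :: real) ^ Suc n) powr \<rho>) summable_on UNIV"
    using summable_geometric_half by (simp add: summable_on_UNIV_nonneg_real_iff del: power_Suc)
  then show ?thesis by (simp add: LProb_def set_pmf_geometric mult.commute)
qed

text \<open>One distribution that carries countably many, the m-th labelled by \<open>m\<close> and
  weighted by \<open>(1/2) ^ Suc m\<close>.\<close>

definition dyadic_mixture :: "(nat \<Rightarrow> 'a pmf) \<Rightarrow> (nat \<times> 'a) pmf" where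
  "dyadic_mixture K = bind_pmf (geometric_pmf (1/2)) (\<lambda>m. map_pmf (Pair m) (K m))"

lemma pmf_dyadic_mixture: "pmf (dyadic_mixture K) (m, y) = (1/2) ^ Suc m * pmf (K m) y"
proof -
  have "pmf (map_pmf (Pair m') (K m')) (m, y) = indicator {m} m' * pmf (K m) y" for m'
  proof (cases "m' = m")
    case True
    then show ?thesis using pmf_map_inj'[of "Pair m" "K m" y] by (simp add: inj_def)
  next
    case False
    then show ?thesis by (auto simp: pmf_eq_0_set_pmf)
  qed
  then show ?thesis
    by (simp add: dyadic_mixture_def pmf_bind measure_pmf_single mult.commute)
qed

text \<open>The mass at \<open>None\<close> is what the other masses leave of 1.\<close>

lemma pmf_eqI_Some:
  assumes "\<And>x. pmf p (Some x) = pmf q (Some x)" shows "p = q"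
proof (rule pmf_eqI)
  fix y
  have "pmf r None = 1 - measure r (range Some)" for r :: "'a option pmf"
  proof -
    have "pmf r None = measure r (UNIV - range Some)"
      by (simp add: pmf.rep_eq UNIV_option_conv insert_Diff_if)
    then show ?thesis using measure_pmf.prob_compl[of "range Some" r] by simp
  qed
  moreover have "measure p (range Some) = measure q (range Some)"
    unfolding measure_pmf_conv_infsetsum by (rule infsetsum_cong) (auto simp: assms)
  ultimately show "pmf p y = pmf q y" using assms by (cases y) auto
qed

lemma map_dyadic_mixture:
  fixes T :: "'b \<Rightarrow> 'a option"
  assumes "\<And>x. pmf (map_pmf T R) (Some x) = pmf (dyadic_mixture K) (m, Some x)"
  shows "map_pmf (\<lambda>(m', y). if m' = m then y else None) (dyadic_mixture K) = map_pmf T R"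
proof (rule pmf_eqI_Some)
  fix x :: 'a
  have "(\<lambda>(m', y). if m' = m then y else None) -` {Some x} = {(m, Some x)}" by (auto split: if_splits)
  then show "pmf (map_pmf (\<lambda>(m', y). if m' = m then y else None) (dyadic_mixture K)) (Some x) = pmf (map_pmf T R) (Some x)"
    unfolding assms by (simp add: pmf_map measure_pmf_single)
qed

text \<open>\<open>F\<close> carries a partial sum within \<epsilon> of the whole series. The same
  \<open>F\<close> bounds the probability of the tail, since \<open>p \<le> p powr \<rho>\<close>
  for \<rho> \<le> 1.\<close>

lemma exists_finite_tail:
  assumes "\<rho> \<le> 1" "P \<in> LProb \<rho>" "\<epsilon> > 0"
  obtains F where "finite F" "\<And>G. \<lbrakk>finite G; G \<inter> F = {}\<rbrakk> \<Longrightarrow> (\<Sum>x\<in>G. pmf P x powr \<rho>) \<le> \<epsilon>"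
    "measure P (- F) \<le> \<epsilon>"
proof -
  have sm: "(\<lambda>x. pmf P x powr \<rho>) summable_on set_pmf P" using assms by (simp add: LProb_def)
  obtain F where F: "finite F" "F \<subseteq> set_pmf P"
      "dist (\<Sum>x\<in>F. pmf P x powr \<rho>) (\<Sum>\<^sub>\<infinity>x\<in>set_pmf P. pmf P x powr \<rho>) \<le> \<epsilon>"
    using infsum_finite_approximation[OF sm \<open>\<epsilon> > 0\<close>] by blast
  have tail: "(\<Sum>x\<in>G. pmf P x powr \<rho>) \<le> \<epsilon>" if G: "finite G" "G \<inter> F = {}" for G
  proof -
    have "(\<Sum>x\<in>G. pmf P x powr \<rho>) = (\<Sum>x\<in>G \<inter> set_pmf P. pmf P x powr \<rho>)"
      by (rule sum.mono_neutral_right) (use G in \<open>auto simp: set_pmf_iff\<close>)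
    moreover have "(\<Sum>x\<in>G \<inter> set_pmf P. pmf P x powr \<rho>) + (\<Sum>x\<in>F. pmf P x powr \<rho>) =
        (\<Sum>x\<in>(G \<inter> set_pmf P) \<union> F. pmf P x powr \<rho>)"
      by (rule sum.union_disjoint[symmetric]) (use G F in auto)
    moreover have "\<dots> \<le> (\<Sum>\<^sub>\<infinity>x\<in>set_pmf P. pmf P x powr \<rho>)"
      by (rule finite_sum_le_infsum[OF sm]) (use G F in auto)
    ultimately show ?thesis using F(3) by (simp add: dist_real_def)
  qed
  have sm': "pmf P summable_on - F"
    using pmf_abs_summable[of P "- F"] abs_summable_summable
    by (metis abs_summable_equivalent)
  have "measure P (- F) = infsum (pmf P) (- F)"
    by (simp add: measure_pmf_conv_infsetsum infsetsum_infsum pmf_abs_summable)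
  also have "\<dots> \<le> \<epsilon>"
  proof (rule infsum_le_finite_sums[OF sm'])
    fix G assume G: "finite G" "G \<subseteq> - F"
    have "pmf P x \<le> pmf P x powr \<rho>" for x
      using powr_mono'[of \<rho> 1 "pmf P x"] assms(1) by (simp add: pmf_le_1)
    then have "sum (pmf P) G \<le> (\<Sum>x\<in>G. pmf P x powr \<rho>)" by (rule sum_mono)
    also have "\<dots> \<le> \<epsilon>" by (rule tail) (use G in auto)
    finally show "sum (pmf P) G \<le> \<epsilon>" .
  qed
  finally show thesis using that F(1) tail by blast
qed

text \<open>With probability \<open>c * measure P (- F)\<close> draw from \<open>P\<close>
  conditioned on \<open>- F\<close>, otherwise return \<open>None\<close>. If \<open>F\<close>
  covers the support, \<open>None\<close> alone will do.\<close>

lemma exists_scaled_tail: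
  fixes P :: "'a pmf"
  assumes "c \<ge> 0" "c * measure P (- F) \<le> 1"
  obtains K :: "'a option pmf" where "\<And>x. pmf K (Some x) = (if x \<in> F then 0 else c * pmf P x)"
proof (cases "set_pmf P \<inter> - F = {}")
  case True
  then have "pmf (return_pmf None :: 'a option pmf) (Some x) = (if x \<in> F then 0 else c * pmf P x)" for x
    by (auto simp: pmf_eq_0_set_pmf)
  then show thesis by (rule that)
next
  case False
  let ?c = "c * measure P (- F)"
  define K where "K = bind_pmf (bernoulli_pmf ?c) (\<lambda>b. if b then map_pmf Some (cond_pmf P (- F)) else return_pmf None)"
  have 0: "measure P (- F) \<noteq> 0" using False by (auto simp: measure_pmf_zero_iff)
  have "pmf K (Some x) = (if x \<in> F then 0 else c * pmf P x)" for x
  proof -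
    have "pmf K (Some x) = ?c * pmf (map_pmf Some (cond_pmf P (- F))) (Some x)"
      unfolding K_def pmf_bind using assms
      by (subst integral_measure_pmf[of UNIV]) (auto simp: UNIV_bool)
    also have "\<dots> = (if x \<in> F then 0 else c * pmf P x)"
      using 0 pmf_map_inj'[of Some "cond_pmf P (- F)" x] by (simp add: pmf_cond[OF False])
    finally show ?thesis .
  qed
  then show thesis by (rule that)
qed

text \<open>\<open>F m\<close> is taken so large that the tail of \<open>R m\<close> has mass at
  most \<open>(1/2) ^ Suc m\<close>. Scaled up by \<open>2 ^ Suc m\<close>, the tail becomes the
  m-th component of a dyadic mixture, whose weight restores the original masses.\<close>

lemma exists_common_refinement_of_tails:
  fixes R :: "nat \<Rightarrow> 'a pmf"
  assumes \<rho>: "0 < \<rho>" "\<rho> \<le> 1" and R: "\<And>m. R m \<in> LProb \<rho>"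
  obtains D :: "(nat \<times> 'a option) pmf" and F :: "nat \<Rightarrow> 'a set" and g
  where "D \<in> LProb \<rho>" "\<And>m. finite (F m)" "\<And>m. map_pmf (g m) D = map_pmf (reveal (- F m)) (R m)"
proof -
  have "\<exists>F. finite F \<and> (\<forall>G. finite G \<longrightarrow> G \<inter> F = {} \<longrightarrow> (\<Sum>x\<in>G. pmf (R m) x powr \<rho>) \<le> (1/2) ^ Suc m) \<and>
      measure (R m) (- F) \<le> (1/2) ^ Suc m" for m
    by (rule exists_finite_tail[OF \<rho>(2) R, of "(1/2) ^ Suc m" m]) (simp, blast)
  then obtain F where F: "\<And>m. finite (F m)"
      "\<And>m G. \<lbrakk>finite G; G \<inter> F m = {}\<rbrakk> \<Longrightarrow> (\<Sum>x\<in>G. pmf (R m) x powr \<rho>) \<le> (1/2) ^ Suc m"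
      "\<And>m. measure (R m) (- F m) \<le> (1/2) ^ Suc m"
    by metis
  have "\<exists>K :: 'a option pmf. \<forall>x. pmf K (Some x) = (if x \<in> F m then 0 else 2 ^ Suc m * pmf (R m) x)" for m
  proof (rule exists_scaled_tail[of "2 ^ Suc m" "R m" "F m"])
    show "2 ^ Suc m * measure (R m) (- F m) \<le> 1" using F(3)[of m] by (simp add: power_divide field_simps)
  qed (simp, blast)
  then obtain K :: "nat \<Rightarrow> 'a option pmf"
    where K: "\<And>m x. pmf (K m) (Some x) = (if x \<in> F m then 0 else 2 ^ Suc m * pmf (R m) x)"
    by metis
  let ?D = "dyadic_mixture K"
  have Some: "pmf ?D (m, Some x) = (if x \<in> F m then 0 else pmf (R m) x)" for m x
    by (simp add: pmf_dyadic_mixture K power_divide)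
  have None: "pmf ?D (m, None) \<le> (1/2) ^ Suc m" for m
    unfolding pmf_dyadic_mixture by (rule mult_left_le) (simp_all add: pmf_le_1)
  \<comment> \<open>\<open>?u m\<close> bounds what component \<open>m\<close> adds to the
    \<rho>-sum: the first term is for \<open>None\<close>, the second for the tail.\<close>
  let ?u = "\<lambda>m. ((1/2 :: real) ^ Suc m) powr \<rho> + (1/2) ^ Suc m"
  have su: "summable ?u"
    using summable_geometric_half[OF \<rho>(1)] summable_geometric_half[of 1]
    by (intro summable_add) (simp_all del: power_Suc)
  have "?D \<in> LProb \<rho>"
    unfolding LProb_def mem_Collect_eq
  proof (rule nonneg_bdd_above_summable_on)
    show "bdd_above (sum (\<lambda>z. pmf ?D z powr \<rho>) ` {G. G \<subseteq> set_pmf ?D \<and> finite G})"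
    proof (rule bdd_aboveI2)
      fix G assume "G \<in> {G. G \<subseteq> set_pmf ?D \<and> finite G}"
      then have fin: "finite G" by simp
      \<comment> \<open>Encloses \<open>G\<close> in a finite box: components below
        \<open>M\<close>, and in each of them \<open>None\<close> and the points of
        \<open>B\<close>.\<close>
      define M where "M = Suc (Max (insert 0 (fst ` G)))"
      define B where "B = {x. Some x \<in> snd ` G}"
      have finB: "finite B" unfolding B_def using fin by (intro finite_inverse_image[of _ Some, unfolded vimage_def]) auto
      have "fst z < M" if "z \<in> G" for z
        unfolding M_def using fin that by (intro le_imp_less_Suc Max_ge) auto
      moreover have "snd z \<in> insert None (Some ` B)" if "z \<in> G" for z
        using that by (cases "snd z") (auto simp: B_def intro!: imageI rev_image_eqI)
      ultimately have "G \<subseteq> {..<M} \<times> insert None (Some ` B)"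
        unfolding subset_iff mem_Times_iff by simp
      then have "(\<Sum>z\<in>G. pmf ?D z powr \<rho>) \<le> (\<Sum>z\<in>{..<M} \<times> insert None (Some ` B). pmf ?D z powr \<rho>)"
        by (intro sum_mono2) (use finB in auto)
      also have "\<dots> = (\<Sum>m<M. \<Sum>y\<in>insert None (Some ` B). pmf ?D (m, y) powr \<rho>)"
        by (simp only: sum.cartesian_product) (simp add: split_def)
      also have "\<dots> = (\<Sum>m<M. pmf ?D (m, None) powr \<rho> + (\<Sum>x\<in>B. pmf ?D (m, Some x) powr \<rho>))"
        using finB by (simp add: sum.reindex)
      also have "\<dots> \<le> (\<Sum>m<M. ?u m)"
      proof (intro sum_mono add_mono)
        fix m
        show "pmf ?D (m, None) powr \<rho> \<le> ((1/2) ^ Suc m) powr \<rho>"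
          by (intro powr_mono2 None) (use \<rho> in auto)
        have "(\<Sum>x\<in>B. pmf ?D (m, Some x) powr \<rho>) = (\<Sum>x\<in>B - F m. pmf (R m) x powr \<rho>)"
          by (rule sum.mono_neutral_cong_right) (use finB in \<open>auto simp: Some\<close>)
        also have "\<dots> \<le> (1/2) ^ Suc m" by (rule F(2)) (use finB in auto)
        finally show "(\<Sum>x\<in>B. pmf ?D (m, Some x) powr \<rho>) \<le> (1/2) ^ Suc m" .
      qed
      also have "\<dots> \<le> suminf ?u" by (rule sum_le_suminf[OF su]) auto
      finally show "(\<Sum>z\<in>G. pmf ?D z powr \<rho>) \<le> suminf ?u" .
    qed
  qed simp
  moreover have "map_pmf (\<lambda>(m', y). if m' = m then y else None) ?D = map_pmf (reveal (- F m)) (R m)" for m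
    by (rule map_dyadic_mixture) (simp add: Some pmf_map_reveal)
  ultimately show thesis by (rule that[OF _ F(1)])
qed

text \<open>Makes the construction of tails, stated for \<rho> \<le> 1, available for every positive
  \<rho>.\<close>

lemma LProb_min_1_iff: "P \<in> LProb \<rho> \<longleftrightarrow> P \<in> LProb (min \<rho> 1)"
  by (cases "\<rho> \<ge> 1") (simp_all add: LProb_eq_UNIV min_def)

text \<open>Component m is uniform on \<open>N m\<close> points. The exponent
  \<open>m * 2 ^ Suc m\<close> in \<open>N m\<close> compensates the weight
  \<open>(1/2) ^ Suc m\<close>, so that the component contributes at least
  \<open>m * ln 2\<close>.\<close>

lemma exists_dyadic_mixture_H1_ge:
  obtains D :: "(nat \<times> nat) pmf" and g :: "nat \<Rightarrow> nat \<times> nat \<Rightarrow> nat option"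
  where "\<And>m. finite (set_pmf (map_pmf (g m) D))" "\<And>m. real m * ln 2 \<le> H1 (map_pmf (g m) D)"
proof -
  define N where "N m = (2 :: nat) ^ (m * 2 ^ Suc m)" for m
  have N: "{..<N m} \<noteq> {}" for m by (auto simp: N_def lessThan_empty_iff)
  define D where "D = dyadic_mixture (\<lambda>m. pmf_of_set {..<N m})"
  define g where "g m = (\<lambda>(m', y). if m' = m \<and> y < N m then Some y else None)" for m :: nat
  let ?T = "\<lambda>m. map_pmf (g m) D"
  have fin: "finite (set_pmf (?T m))" for m
    by (rule finite_subset[of _ "insert None (Some ` {..<N m})"]) (auto simp: g_def split: if_splits)
  have "real m * ln 2 \<le> H1 (?T m)" for m
  proof -
    let ?p = "(1/2) ^ Suc m / real (N m)"
    have p: "0 < ?p" by (simp add: N_def)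
    have pmf: "pmf (?T m) (Some y) = ?p" if "y < N m" for y
    proof -
      have "g m -` {Some y} = {(m, y)}" using that by (auto simp: g_def split: if_splits)
      then show ?thesis using that N[of m]
        by (simp add: pmf_map measure_pmf_single D_def pmf_dyadic_mixture)
    qed
    have "- (\<Sum>z\<in>Some ` {..<N m}. pmf (?T m) z * ln (pmf (?T m) z)) = - (\<Sum>y<N m. ?p * ln ?p)"
      by (subst sum.reindex) (auto simp: pmf)
    also have "\<dots> = (1/2) ^ Suc m * - ln ?p" by (simp add: N_def)
    also have "- ln ?p = ln (2 ^ Suc m) + ln (real (N m))"
      by (simp add: ln_div ln_mult N_def power_divide)
    finally have "(1/2) ^ Suc m * (ln (2 ^ Suc m) + ln (real (N m))) \<le> H1 (?T m)"
      using sum_le_H1[OF fin, of "Some ` {..<N m}" m] by simp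
    moreover have "(1/2) ^ Suc m * ln (real (N m)) = real m * ln 2"
      by (simp add: N_def ln_realpow power_divide)
    moreover have "0 \<le> (1/2) ^ Suc m * ln (2 ^ Suc m :: real)"
      by (intro mult_nonneg_nonneg ln_ge_zero one_le_power) auto
    ultimately show ?thesis by (simp only: distrib_left)
  qed
  with fin show thesis by (rule that)
qed

section \<open>Comparison of distributions for positive \<rho>\<close>

context entropy
begin

text \<open>The geometric distribution has images of any finite support size. A suitable one,
  adjoined to the n-th power of \<open>P\<close>, makes the supports comparable, and its cost is at
  most \<open>E ?D\<close> for every n.\<close>

lemma E_ge_finite_pos:
  fixes P :: "'a pmf" and Q :: "'b pmf"
  assumes \<rho>: "0 < \<rho>" and finP: "finite (set_pmf P)" and finQ: "finite (set_pmf Q)" and le: "H1 Q \<le> H1 P"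
  shows "E P \<succeq> E Q"
proof (rule ge_of_pow_mult)
  let ?D = "geometric_pmf (1/2)"
  have P: "P \<in> LProb \<rho>" and Q: "Q \<in> LProb \<rho>" and D: "?D \<in> LProb \<rho>"
    using finP finQ \<rho> by (auto simp: FinProb_imp_LProb LProb_geometric)
  show "E P \<in> carrier W" "E Q \<in> carrier W" "E ?D \<in> carrier W" using P Q D by (auto simp: E_carrier)
  fix n :: nat
  define k where "k = card (set_pmf Q) ^ n"
  let ?Dk = "map_pmf (min k) ?D"
  have "set_pmf ?Dk = {..k}" by (auto simp: set_pmf_geometric image_iff) (metis min.absorb2)
  then have finD: "finite (set_pmf ?Dk)" and cardD: "card (set_pmf ?Dk) = Suc k" by auto
  have "E (pair_pmf (replicate_pmf n P) ?Dk) \<succeq> E (replicate_pmf n Q)"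
  proof (rule E_ge_finite)
    show "finite (set_pmf (pair_pmf (replicate_pmf n P) ?Dk))" "finite (set_pmf (replicate_pmf n Q))"
      using finP finQ finD by (auto simp: finite_set_replicate_pmf)
    have "card (set_pmf P) \<noteq> 0" using finP by (simp add: set_pmf_not_empty)
    then have "1 * Suc k \<le> card (set_pmf P) ^ n * Suc k" by (intro mult_right_mono) auto
    then show "card (set_pmf (replicate_pmf n Q)) \<le> card (set_pmf (pair_pmf (replicate_pmf n P) ?Dk))"
      using finP finQ cardD by (simp add: card_set_replicate_pmf card_cartesian_product k_def del: set_map_pmf)
    have "real n * H1 Q \<le> real n * H1 P" using le by (rule mult_left_mono) simp
    then show "H1 (replicate_pmf n Q) \<le> H1 (pair_pmf (replicate_pmf n P) ?Dk)"
      using finP finQ finD H1_nonneg[OF fin_H1_finite[OF finD]]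
      by (simp add: H1_pair H1_replicate fin_H1_finite fin_H1_replicate del: set_map_pmf)
  qed
  then have "E P [^] n \<otimes> E ?Dk \<succeq> E Q [^] n"
    using P Q D by (simp add: E_pair E_replicate LProb_replicate LProb_map)
  moreover have "E P [^] n \<otimes> E ?D \<succeq> E P [^] n \<otimes> E ?Dk"
    using P D by (intro geq_mult ge_refl E_map_le) (auto simp: E_carrier LProb_map)
  ultimately show "E P [^] n \<otimes> E ?D \<succeq> E Q [^] n"
    using P Q D by (meson ge_trans m_closed nat_pow_closed E_carrier LProb_map)
qed

text \<open>A sequence is determined by its part revealed on \<open>F n\<close> and its tail. The
  first part is paid for by hypothesis; the tails of all powers are images of the single
  \<open>D\<close> and so cost at most \<open>E D\<close>.\<close>

lemma E_le_of_reveal: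
  fixes Q :: "'a pmf"
  assumes \<rho>: "0 < \<rho>" and Q: "Q \<in> LProb \<rho>" and Y: "Y \<in> carrier W"
    and le: "\<And>n F. finite F \<Longrightarrow> Y [^] n \<succeq> E (map_pmf (reveal F) (replicate_pmf n Q))"
  shows "Y \<succeq> E Q"
proof -
  let ?R = "\<lambda>n. replicate_pmf n Q"
  have "0 < min \<rho> 1" "min \<rho> 1 \<le> 1" using \<rho> by auto
  moreover have "?R n \<in> LProb (min \<rho> 1)" for n
    using LProb_replicate[OF Q] LProb_min_1_iff by blast
  ultimately obtain D :: "(nat \<times> 'a list option) pmf" and F g
    where D: "D \<in> LProb (min \<rho> 1)" and F: "\<And>n. finite (F n)"
      and g: "\<And>n. map_pmf (g n) D = map_pmf (reveal (- F n)) (?R n)"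
    by (rule exists_common_refinement_of_tails[where R = ?R]) blast
  have D: "D \<in> LProb \<rho>" using D LProb_min_1_iff by blast
  show ?thesis
  proof (rule ge_of_pow_mult)
    show "Y \<in> carrier W" "E Q \<in> carrier W" "E D \<in> carrier W" using Y Q D by (auto simp: E_carrier)
    fix n :: nat
    have R: "?R n \<in> LProb \<rho>" by (rule LProb_replicate[OF Q])
    let ?f = "reveal (F n)" and ?t = "reveal (- F n)"
    have c: "E (map_pmf ?f (?R n)) \<in> carrier W" "E (map_pmf ?t (?R n)) \<in> carrier W"
      "E (map_pmf (\<lambda>x. (?f x, ?t x)) (?R n)) \<in> carrier W"
      using R by (auto intro!: E_carrier LProb_map)
    have "E D \<succeq> E (map_pmf ?t (?R n))" using E_map_le[OF D, of "g n"] by (simp add: g)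
    then have "Y [^] n \<otimes> E D \<succeq> E (map_pmf ?f (?R n)) \<otimes> E (map_pmf ?t (?R n))"
      using le[OF F] c Y D by (intro geq_mult) (auto simp: E_carrier)
    moreover have "\<dots> \<succeq> E (map_pmf (\<lambda>x. (?f x, ?t x)) (?R n))" by (rule E_joint[OF R])
    moreover have "E (map_pmf (\<lambda>x. (?f x, ?t x)) (?R n)) = E (?R n)"
      by (rule E_map_inj[OF R]) (auto simp: inj_on_def reveal_def split: if_splits)
    ultimately show "Y [^] n \<otimes> E D \<succeq> E Q [^] n"
      using ge_trans[of "Y [^] n \<otimes> E D"] c Y D Q by (simp add: E_replicate E_carrier)
  qed
qed

text \<open>First the strict inequality with finite \<open>Q\<close>, where \<open>P\<close> is
  replaced by a finite image whose entropy still exceeds \<open>H1 Q\<close>; then equality, by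
  adjoining a fair bit; finally infinite \<open>Q\<close>, by \<open>E_le_of_reveal\<close>.\<close>

lemma E_ge_lt_1:
  fixes P :: "'a pmf" and Q :: "'b pmf"
  assumes \<rho>: "0 < \<rho>" "\<rho> < 1" and P: "P \<in> LProb \<rho>" and Q: "Q \<in> LProb \<rho>" and le: "H1 Q \<le> H1 P"
  shows "E P \<succeq> E Q"
proof -
  have fin_H1: "fin_H1 R" if "R \<in> LProb \<rho>" for R :: "'z pmf" using fin_H1_LProb \<rho> that by blast
  have less: "E P \<succeq> E Q" if lt: "H1 Q < H1 P" and P: "P \<in> LProb \<rho>" and fin: "finite (set_pmf Q)" for P :: "'x pmf" and Q :: "'y pmf"
  proof -
    obtain F where F: "finite F" "H1 Q < H1 (map_pmf (reveal F) P)"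
      by (rule exists_reveal_H1_greater[OF fin_H1[OF P] lt])
    have "E (map_pmf (reveal F) P) \<succeq> E Q"
      using F(2) by (intro E_ge_finite_pos \<rho>(1) finite_set_pmf_reveal[OF F(1)] fin) simp
    with E_map_le[OF P, of "reveal F"] show ?thesis
      using P fin by (meson ge_trans E_carrier LProb_map FinProb_imp_LProb)
  qed
  have finite: "E P \<succeq> E Q" if le: "H1 Q \<le> H1 P" and P: "P \<in> LProb \<rho>" and fin: "finite (set_pmf Q)"
    for P :: "'x pmf" and Q :: "'y pmf"
  proof (rule ge_of_pow_mult)
    let ?B = "pmf_of_set (UNIV :: bool set)"
    have Q: "Q \<in> LProb \<rho>" and B: "?B \<in> LProb \<rho>" using fin by (auto simp: FinProb_imp_LProb)
    show "E P \<in> carrier W" "E Q \<in> carrier W" "E ?B \<in> carrier W" using P Q B by (auto simp: E_carrier)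
    fix n :: nat
    have "E (pair_pmf (replicate_pmf n P) ?B) \<succeq> E (replicate_pmf n Q)"
    proof (rule less)
      have "H1 ?B = ln 2" by (subst H1_pmf_of_set) auto
      moreover have "real n * H1 Q \<le> real n * H1 P" using le by (rule mult_left_mono) simp
      then have "real n * H1 Q < real n * H1 P + ln 2" using ln_gt_zero[of "2 :: real"] by linarith
      ultimately show "H1 (replicate_pmf n Q) < H1 (pair_pmf (replicate_pmf n P) ?B)"
        using P Q B by (simp add: H1_pair H1_replicate fin_H1 fin_H1_replicate)
    qed (use P B fin in \<open>auto intro: LProb_pair LProb_replicate simp: finite_set_replicate_pmf\<close>)
    then show "E P [^] n \<otimes> E ?B \<succeq> E Q [^] n"
      using P Q B by (simp add: E_pair E_replicate LProb_replicate)
  qed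
  show ?thesis
  proof (rule E_le_of_reveal[OF \<rho>(1) Q E_carrier[OF P]])
    fix n and F :: "'b list set" assume F: "finite F"
    have "H1 (map_pmf (reveal F) (replicate_pmf n Q)) \<le> H1 (replicate_pmf n Q)"
      by (rule H1_map_le) (rule fin_H1[OF LProb_replicate[OF Q]])
    also have "\<dots> \<le> H1 (replicate_pmf n P)"
      using le P Q by (simp add: H1_replicate fin_H1 mult_left_mono)
    finally have "E (replicate_pmf n P) \<succeq> E (map_pmf (reveal F) (replicate_pmf n Q))"
      by (rule finite[OF _ LProb_replicate[OF P] finite_set_pmf_reveal[OF F]])
    then show "E P [^] n \<succeq> E (map_pmf (reveal F) (replicate_pmf n Q))"
      by (simp add: E_replicate P)
  qed
qed

text \<open>For \<rho> \<ge> 1 the dyadic mixture \<open>D\<close> with images of unbounded entropy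
  lies in \<open>LProb \<rho>\<close>. It dominates every power of a finite distribution, whose
  value is therefore at most \<one>; \<open>E_le_of_reveal\<close> extends this to infinite
  ones.\<close>

lemma E_eq_one:
  fixes Q :: "'a pmf"
  assumes \<rho>: "1 \<le> \<rho>" shows "E Q = \<one>"
proof -
  have L: "R \<in> LProb \<rho>" for R :: "'z pmf" using LProb_eq_UNIV[OF \<rho>] .
  have c: "E R \<in> carrier W" for R :: "'z pmf" by (rule E_carrier[OF L])
  have \<rho>0: "0 < \<rho>" using \<rho> by simp
  obtain D :: "(nat \<times> nat) pmf" and g where fin: "\<And>m. finite (set_pmf (map_pmf (g m) D))"
      and H: "\<And>m. real m * ln 2 \<le> H1 (map_pmf (g m) D :: nat option pmf)"
    by (rule exists_dyadic_mixture_H1_ge) blast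
  have finite: "\<one> \<succeq> E R" if finR: "finite (set_pmf R)" for R :: "'z pmf"
  proof (rule ge_of_pow_mult)
    show "E R \<in> carrier W" "E D \<in> carrier W" "\<one> \<in> carrier W" using c by auto
    fix n :: nat
    obtain m where "real n * H1 R / ln 2 \<le> real m" using real_arch_simple by blast
    then have "H1 (replicate_pmf n R) \<le> real m * ln 2"
      using finR by (simp add: H1_replicate fin_H1_finite pos_divide_le_eq)
    also note H
    finally have "E (map_pmf (g m) D) \<succeq> E (replicate_pmf n R)"
      by (intro E_ge_finite_pos[OF \<rho>0 fin]) (simp add: finR finite_set_replicate_pmf)
    from ge_trans[OF E_map_le[OF L] this] have "E D \<succeq> E (replicate_pmf n R)" by (simp add: c)
    then show "\<one> [^] n \<otimes> E D \<succeq> E R [^] n" using E_carrier[OF L, of D] by (simp add: E_replicate L)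
  qed
  have "\<one> \<succeq> E Q"
    by (rule E_le_of_reveal[OF \<rho>0 L]) (auto intro: finite finite_set_pmf_reveal simp del: set_map_pmf)
  then show ?thesis using E_nonneg[OF L] c by (intro ge_antisym) auto
qed

end

section \<open>Entropies on under categories\<close>

lemma map_restrict_set_pmf [simp]: "map_pmf (restrict f (set_pmf P)) P = map_pmf f P"
  by (rule map_pmf_cong) auto

lemma map_compose_set_pmf [simp]: "map_pmf (compose (set_pmf P) X f) P = map_pmf X (map_pmf f P)"
  unfolding pmf.map_comp by (rule map_pmf_cong) (auto simp: compose_def)

lemma restrict_in_LProb_hom: "P \<in> LProb \<rho> \<Longrightarrow> restrict f (set_pmf P) \<in> LProb_hom \<rho> P (map_pmf f P)"
  by (auto simp: LProb_hom_def LProb_map)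

lemma restrict_in_under_obj: "P \<in> LProb \<rho> \<Longrightarrow> restrict f (set_pmf P) \<in> under_obj \<rho> P"
  using restrict_in_LProb_hom unfolding under_obj_def by blast

lemma under_objD: "X \<in> under_obj \<rho> P \<Longrightarrow> X \<in> LProb_hom \<rho> P (cod P X)"
  by (auto simp: under_obj_def LProb_hom_def cod_def)

lemma LProb_id_in_under_obj: "P \<in> LProb \<rho> \<Longrightarrow> LProb_id P \<in> under_obj \<rho> P"
  unfolding LProb_id_def by (rule restrict_in_under_obj)

lemma cod_LProb_id [simp]: "cod P (LProb_id P) = P"
  by (simp add: cod_def LProb_id_def)

lemma LProb_LProb_tensor: "\<lbrakk>P \<in> LProb \<rho>; Q \<in> LProb \<rho>\<rbrakk> \<Longrightarrow> LProb_tensor P Q \<in> LProb \<rho>"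
  unfolding LProb_tensor_def by (intro LProb_map LProb_pair)

lemma LProb_LProb_unit: "LProb_unit \<in> LProb \<rho>"
  by (simp add: LProb_unit_def FinProb_imp_LProb)

lemma cod_under_unit: "cod P (under_unit P) = LProb_unit"
  by (simp add: cod_def under_unit_def LProb_unit_def map_pmf_const)

lemma cod_tensor_map:
  "cod (LProb_tensor P Q) (tensor_map P Q X Y) = LProb_tensor (cod P X) (cod Q Y)"
  unfolding cod_def tensor_map_def map_restrict_set_pmf
  unfolding LProb_tensor_def by (simp add: pmf.map_comp o_def split_def map_pair[symmetric])

text \<open>Precomposition with a morphism leaves the codomain unchanged, which gives naturality.
  The other laws are those of \<open>\<phi>\<close> at codomains.\<close>

lemma entropy_into_cod:
  fixes W :: "'w ord_monoid" (structure) and \<phi> :: "'u::points pmf \<Rightarrow> 'w"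
  assumes "entropy W \<rho> \<phi>"
  shows "entropy_into \<rho> W (\<lambda>P X. \<phi> (cod P X))"
proof -
  interpret entropy W \<rho> \<phi> by fact
  have cod: "cod P X \<in> LProb \<rho>" if "X \<in> under_obj \<rho> P" for P :: "'u pmf" and X
    using under_objD[OF that] by (simp add: LProb_hom_def)
  have "\<phi> (cod P X) \<succeq> \<phi> (cod P X')" if X: "X \<in> under_obj \<rho> P" and hom: "under_hom \<rho> P X X' \<noteq> {}" for P X X'
  proof -
    obtain f where "f \<in> LProb_hom \<rho> (cod P X) (cod P X')" using hom by (auto simp: under_hom_def)
    then have "cod P X' = map_pmf f (cod P X)" by (simp add: LProb_hom_def)
    then show ?thesis using H_map[OF cod[OF X]] by simp
  qed
  moreover have "\<phi> (cod P X) \<otimes> \<phi> (cod P Y) \<succeq> \<phi> (cod P (under_tensor P X Y))" if "P \<in> LProb \<rho>" for P X Y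
    using H_joint[OF that, of X Y] by (simp add: cod_def under_tensor_def)
  moreover have "\<phi> (cod P (compose (set_pmf P) X f)) = \<phi> (cod Q X)" if "f \<in> LProb_hom \<rho> P Q" for P Q f X
    using that by (simp add: cod_def LProb_hom_def)
  ultimately show ?thesis
    unfolding entropy_into_def using cod H_carrier
    by (auto simp: cod_under_unit cod_tensor_map H_unit H_tensor ge_refl)
qed

text \<open>Naturality along \<open>X\<close> itself, applied to the identity of its codomain,
  reduces every value of \<open>h\<close> to a baseless one. The laws on under categories thereby
  become those of the locale \<open>entropy\<close>.\<close>

lemma
  fixes W :: "'w ord_monoid" (structure) and h :: "'u::points pmf \<Rightarrow> ('u \<Rightarrow> 'u) \<Rightarrow> 'w"
  assumes h: "ic_entropy \<rho> W h"
  shows ic_entropy_eq_cod: "\<And>P X. \<lbrakk>P \<in> LProb \<rho>; X \<in> under_obj \<rho> P\<rbrakk> \<Longrightarrow> h P X = h (cod P X) (LProb_id (cod P X))"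
    and entropy_of_ic_entropy: "entropy W \<rho> (\<lambda>P. h P (LProb_id P))"
proof -
  interpret ic_monoid W using h by (simp add: ic_monoid_iff ic_entropy_def)
  have carrier: "\<And>P X. \<lbrakk>P \<in> LProb \<rho>; X \<in> under_obj \<rho> P\<rbrakk> \<Longrightarrow> h P X \<in> carrier W"
    and mono: "\<And>P X X'. \<lbrakk>P \<in> LProb \<rho>; X \<in> under_obj \<rho> P; X' \<in> under_obj \<rho> P; under_hom \<rho> P X X' \<noteq> {}\<rbrakk>
      \<Longrightarrow> h P X \<succeq> h P X'"
    and joint: "\<And>P X Y. \<lbrakk>P \<in> LProb \<rho>; X \<in> under_obj \<rho> P; Y \<in> under_obj \<rho> P\<rbrakk>
      \<Longrightarrow> h P X \<otimes> h P Y \<succeq> h P (under_tensor P X Y)"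
    and comp: "\<And>P Q f X. \<lbrakk>P \<in> LProb \<rho>; Q \<in> LProb \<rho>; f \<in> LProb_hom \<rho> P Q; X \<in> under_obj \<rho> Q\<rbrakk>
      \<Longrightarrow> h P (compose (set_pmf P) X f) = h Q X"
    and tensor: "\<And>P Q X Y. \<lbrakk>P \<in> LProb \<rho>; Q \<in> LProb \<rho>; X \<in> under_obj \<rho> P; Y \<in> under_obj \<rho> Q\<rbrakk>
      \<Longrightarrow> h (LProb_tensor P Q) (tensor_map P Q X Y) = h P X \<otimes> h Q Y"
    and unit: "h LProb_unit (under_unit LProb_unit) = \<one>"
    using h unfolding ic_entropy_def entropy_into_def by blast+
  show cod: "h P X = h (cod P X) (LProb_id (cod P X))" if P: "P \<in> LProb \<rho>" and X: "X \<in> under_obj \<rho> P" for P X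
  proof -
    have X': "X \<in> LProb_hom \<rho> P (cod P X)" and Q: "cod P X \<in> LProb \<rho>"
      using under_objD[OF X] by (auto simp: LProb_hom_def)
    have "compose (set_pmf P) (LProb_id (cod P X)) X = X"
      using X' by (intro ext) (auto simp: compose_def LProb_id_def LProb_hom_def PiE_iff extensional_def)
    then show ?thesis using comp[OF P Q X' LProb_id_in_under_obj[OF Q]] by simp
  qed
  have cod_restrict: "h P (restrict f (set_pmf P)) = h (map_pmf f P) (LProb_id (map_pmf f P))"
    if "P \<in> LProb \<rho>" for P f
    using cod[OF that restrict_in_under_obj[OF that]] by (simp add: cod_def)
  show "entropy W \<rho> (\<lambda>P. h P (LProb_id P))"
  proof
    fix P Q :: "'u pmf" and f X Y :: "'u \<Rightarrow> 'u"
    assume P: "P \<in> LProb \<rho>"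
    show "h P (LProb_id P) \<in> carrier W" by (intro carrier P LProb_id_in_under_obj)
    \<comment> \<open>Seen as a morphism out of the identity, \<open>f\<close> leads to the random
      variable \<open>f\<close>, so monotonicity of \<open>h\<close> applies.\<close>
    have "restrict f (set_pmf P) \<in> under_hom \<rho> P (LProb_id P) (restrict f (set_pmf P))"
      using restrict_in_LProb_hom[OF P, of f]
      by (auto simp: under_hom_def cod_def[of _ "restrict f _"] compose_def) (auto simp: LProb_id_def)
    then show "h P (LProb_id P) \<succeq> h (map_pmf f P) (LProb_id (map_pmf f P))"
      unfolding cod_restrict[OF P, symmetric]
      by (intro mono P LProb_id_in_under_obj restrict_in_under_obj) blast
    have "under_tensor P (restrict X (set_pmf P)) (restrict Y (set_pmf P)) =
        restrict (\<lambda>\<omega>. pt_pair (X \<omega>) (Y \<omega>)) (set_pmf P)"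
      by (auto simp: under_tensor_def)
    then show "h (map_pmf X P) (LProb_id (map_pmf X P)) \<otimes> h (map_pmf Y P) (LProb_id (map_pmf Y P)) \<succeq>
        h (map_pmf (\<lambda>\<omega>. pt_pair (X \<omega>) (Y \<omega>)) P) (LProb_id (map_pmf (\<lambda>\<omega>. pt_pair (X \<omega>) (Y \<omega>)) P))"
      using joint[OF P restrict_in_under_obj[OF P] restrict_in_under_obj[OF P], of X Y]
      by (simp add: cod_restrict P)
    assume Q: "Q \<in> LProb \<rho>"
    have "tensor_map P Q (LProb_id P) (LProb_id Q) = LProb_id (LProb_tensor P Q)"
      by (auto simp: tensor_map_def LProb_id_def LProb_tensor_def restrict_def fun_eq_iff)
    then show "h (LProb_tensor P Q) (LProb_id (LProb_tensor P Q)) = h P (LProb_id P) \<otimes> h Q (LProb_id Q)"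
      using tensor[OF P Q LProb_id_in_under_obj LProb_id_in_under_obj, OF P Q] by simp
  next
    have "under_unit LProb_unit = LProb_id (LProb_unit :: 'u pmf)"
      by (auto simp: under_unit_def LProb_id_def LProb_unit_def restrict_def fun_eq_iff)
    then show "h LProb_unit (LProb_id LProb_unit) = \<one>" using unit by simp
  qed
qed

section \<open>From comparison of values to the universal property\<close>

text \<open>Since \<open>\<phi>\<close> is onto, \<open>t (\<phi> P) = H P\<close> determines
  \<open>t\<close>. Applying \<open>le\<close> in both directions makes \<open>t\<close> well
  defined, and in one direction monotone; tensor products make it additive.\<close>

lemma ex1_OrdCMon_hom:
  fixes \<phi> :: "'u::points pmf \<Rightarrow> 'w" and H :: "'u pmf \<Rightarrow> 'v"
  assumes \<phi>: "entropy W \<rho> \<phi>" and H: "entropy W' \<rho> H"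
    and surj: "carrier W = \<phi> ` LProb \<rho>"
    and le: "\<And>P Q. \<lbrakk>P \<in> LProb \<rho>; Q \<in> LProb \<rho>; \<phi> P \<succeq>\<^bsub>W\<^esub> \<phi> Q\<rbrakk> \<Longrightarrow> H P \<succeq>\<^bsub>W'\<^esub> H Q"
  shows "\<exists>!t. t \<in> OrdCMon_hom W W' \<and> (\<forall>P\<in>LProb \<rho>. H P = t (\<phi> P))"
proof -
  interpret A: entropy W \<rho> \<phi> by fact
  interpret B: entropy W' \<rho> H by fact
  define t where "t = (\<lambda>w\<in>carrier W. H (SOME P. P \<in> LProb \<rho> \<and> \<phi> P = w))"
  have t: "t (\<phi> P) = H P" if P: "P \<in> LProb \<rho>" for P
  proof -
    let ?P = "SOME P'. P' \<in> LProb \<rho> \<and> \<phi> P' = \<phi> P"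
    have P': "?P \<in> LProb \<rho> \<and> \<phi> ?P = \<phi> P" by (rule someI[of _ P]) (simp add: P)
    then have "H ?P = H P"
      using P le[of ?P P] le[of P ?P] A.ge_refl[OF A.H_carrier[OF P]]
      by (intro B.ge_antisym B.H_carrier) auto
    then show ?thesis using A.H_carrier[OF P] by (simp add: t_def)
  qed
  have hom: "t \<in> OrdCMon_hom W W'"
    unfolding OrdCMon_hom_def
  proof (intro CollectI conjI ballI impI)
    show "t \<in> carrier W \<rightarrow>\<^sub>E carrier W'"
      using t B.H_carrier by (auto simp: surj) (simp add: t_def surj)
    show "t \<in> hom W W'"
      unfolding hom_def using B.H_carrier
      by (auto simp: surj t LProb_LProb_tensor B.H_tensor simp flip: A.H_tensor)
    show "t \<one>\<^bsub>W\<^esub> = \<one>\<^bsub>W'\<^esub>"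
      using t[OF LProb_LProb_unit] by (simp add: A.H_unit B.H_unit)
    show "t x \<succeq>\<^bsub>W'\<^esub> t y" if "x \<in> carrier W" "y \<in> carrier W" "x \<succeq>\<^bsub>W\<^esub> y" for x y
      using that le by (auto simp: surj t)
  qed
  show ?thesis
  proof (rule ex1I[of _ t])
    show "t \<in> OrdCMon_hom W W' \<and> (\<forall>P\<in>LProb \<rho>. H P = t (\<phi> P))" using hom t by simp
    fix t' assume t': "t' \<in> OrdCMon_hom W W' \<and> (\<forall>P\<in>LProb \<rho>. H P = t' (\<phi> P))"
    show "t' = t"
    proof
      fix w
      show "t' w = t w"
      proof (cases "w \<in> carrier W")
        case True
        then show ?thesis using t' t by (auto simp: surj)
      next
        case False
        then show ?thesis using t' by (auto simp: t_def OrdCMon_hom_def PiE_iff extensional_def)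
      qed
    qed
  qed
qed

text \<open>Both universal properties ask for the same \<open>t\<close>, because the values of an
  entropy on under categories are its baseless values at codomains.\<close>

lemma universal_entropyI:
  fixes \<phi> :: "'u::points pmf \<Rightarrow> 'w"
  assumes \<phi>: "entropy W \<rho> \<phi>" and surj: "carrier W = \<phi> ` LProb \<rho>"
    and le: "\<And>(W' :: 'v ord_monoid) H P Q. \<lbrakk>entropy W' \<rho> H; P \<in> LProb \<rho>; Q \<in> LProb \<rho>; \<phi> P \<succeq>\<^bsub>W\<^esub> \<phi> Q\<rbrakk>
      \<Longrightarrow> H P \<succeq>\<^bsub>W'\<^esub> H Q"
  shows "universal_ic_entropy TYPE('v) \<rho> W (\<lambda>P X. \<phi> (cod P X)) \<and>
    universal_baseless_ic_entropy TYPE('v) \<rho> W \<phi>"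
proof -
  interpret entropy W \<rho> \<phi> by fact
  have W: "W \<in> IcOrdCMon" using ic_monoid_axioms by (simp add: ic_monoid_iff)
  have ent: "ic_entropy \<rho> W (\<lambda>P X. \<phi> (cod P X))"
    using W entropy_into_cod[OF \<phi>] by (simp add: ic_entropy_def)
  have base: "baseless_ic_entropy \<rho> W \<phi>"
    unfolding baseless_ic_entropy_def by (intro exI[of _ "\<lambda>P X. \<phi> (cod P X)"] conjI ent) simp
  have ex1: "\<exists>!t. t \<in> OrdCMon_hom W W' \<and> (\<forall>P\<in>LProb \<rho>. h' P (LProb_id P) = t (\<phi> P))"
    if "ic_entropy \<rho> W' h'" for W' :: "'v ord_monoid" and h'
    by (rule ex1_OrdCMon_hom[OF \<phi> entropy_of_ic_entropy[OF that] surj])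
       (rule le[OF entropy_of_ic_entropy[OF that]])
  have under: "(\<forall>P\<in>LProb \<rho>. \<forall>X\<in>under_obj \<rho> P. h' P X = t (\<phi> (cod P X))) \<longleftrightarrow>
      (\<forall>P\<in>LProb \<rho>. h' P (LProb_id P) = t (\<phi> P))"
    if "ic_entropy \<rho> W' h'" for W' :: "'v ord_monoid" and h' t
  proof (intro iffI ballI)
    fix P :: "'u pmf"
    assume P: "P \<in> LProb \<rho>" and *: "\<forall>P\<in>LProb \<rho>. \<forall>X\<in>under_obj \<rho> P. h' P X = t (\<phi> (cod P X))"
    then show "h' P (LProb_id P) = t (\<phi> P)" using LProb_id_in_under_obj[OF P] by force
  next
    fix P :: "'u pmf" and X
    assume P: "P \<in> LProb \<rho>" and X: "X \<in> under_obj \<rho> P"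
      and *: "\<forall>P\<in>LProb \<rho>. h' P (LProb_id P) = t (\<phi> P)"
    have "cod P X \<in> LProb \<rho>" using P by (simp add: cod_def LProb_map)
    with * show "h' P X = t (\<phi> (cod P X))" using ic_entropy_eq_cod[OF that P X] by simp
  qed
  have "\<exists>!t. t \<in> OrdCMon_hom W W' \<and> (\<forall>P\<in>LProb \<rho>. H' P = t (\<phi> P))"
    if H': "baseless_ic_entropy \<rho> W' H'" for W' :: "'v ord_monoid" and H'
  proof -
    obtain h' where h': "ic_entropy \<rho> W' h'" "\<forall>P\<in>LProb \<rho>. H' P = h' P (LProb_id P)"
      using H' unfolding baseless_ic_entropy_def by blast
    then have "(\<forall>P\<in>LProb \<rho>. H' P = t (\<phi> P)) \<longleftrightarrow> (\<forall>P\<in>LProb \<rho>. h' P (LProb_id P) = t (\<phi> P))" for t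
      by simp
    with ex1[OF h'(1)] show ?thesis by simp
  qed
  moreover have "\<exists>!t. t \<in> OrdCMon_hom W W' \<and> (\<forall>P\<in>LProb \<rho>. \<forall>X\<in>under_obj \<rho> P. h' P X = t (\<phi> (cod P X)))"
    if "ic_entropy \<rho> W' h'" for W' :: "'v ord_monoid" and h'
    using ex1[OF that] by (simp only: under[OF that])
  ultimately show ?thesis
    unfolding universal_ic_entropy_def universal_baseless_ic_entropy_def using ent base by blast
qed

section \<open>Hartley and Shannon entropy are entropies\<close>

text \<open>Integral closedness is the Archimedean property in each coordinate: if \<open>y\<close>
  exceeded \<open>x\<close> in one, its n-fold excess would outgrow the fixed difference of
  \<open>a\<close> and \<open>b\<close>.\<close>

lemma ic_monoid_additive:
  fixes S :: "'w::ordered_euclidean_space set"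
  assumes "0 \<in> S" and "\<And>x y. \<lbrakk>x \<in> S; y \<in> S\<rbrakk> \<Longrightarrow> x + y \<in> S"
  shows "ic_monoid (additive_ord_monoid S)"
proof -
  let ?W = "additive_ord_monoid S"
  interpret comm_monoid ?W
    by (rule comm_monoidI) (use assms in \<open>auto simp: additive_ord_monoid_def algebra_simps\<close>)
  have "ord_comm_monoid ?W"
    by unfold_locales
       (auto simp: additive_ord_monoid_def reflp_on_def antisymp_on_def transp_on_def intro: add_mono)
  moreover have pow: "x [^]\<^bsub>?W\<^esub> n = real n *\<^sub>R x" for x and n :: nat
    by (induction n) (simp_all add: additive_ord_monoid_def nat_pow_def algebra_simps)
  have "integrally_closed ?W"
    unfolding integrally_closed_def
  proof (intro ballI impI)
    fix x y a b
    assume "\<forall>n::nat. n \<ge> 1 \<longrightarrow> (x [^]\<^bsub>?W\<^esub> n) \<otimes>\<^bsub>?W\<^esub> a \<succeq>\<^bsub>?W\<^esub> (y [^]\<^bsub>?W\<^esub> n) \<otimes>\<^bsub>?W\<^esub> b"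
    then have le: "real n *\<^sub>R y + b \<le> real n *\<^sub>R x + a" if "n \<ge> 1" for n
      using that unfolding pow by (simp add: additive_ord_monoid_def)
    have "y \<bullet> i \<le> x \<bullet> i" if "i \<in> Basis" for i
    proof (rule ccontr)
      assume "\<not> y \<bullet> i \<le> x \<bullet> i"
      then obtain n :: nat where n: "\<bar>a \<bullet> i - b \<bullet> i\<bar> < real n * (y \<bullet> i - x \<bullet> i)"
        using reals_Archimedean3[of "y \<bullet> i - x \<bullet> i"] by auto
      then have "n \<ge> 1" by (cases n) auto
      from le[OF this] have "(real n *\<^sub>R y + b) \<bullet> i \<le> (real n *\<^sub>R x + a) \<bullet> i"
        by (rule eucl_le[THEN iffD1, rule_format, OF _ that])
      with n show False by (simp add: inner_add_left algebra_simps)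
    qed
    then show "x \<succeq>\<^bsub>?W\<^esub> y" by (simp add: additive_ord_monoid_def eucl_le[of y])
  qed
  ultimately show ?thesis by (simp add: ic_monoid_def ic_monoid_axioms_def)
qed

text \<open>The range \<open>S\<close> is closed under addition because sums are values at tensor
  products, so it is a monoid.\<close>

lemma entropy_additiveI:
  fixes \<phi> :: "'u::points pmf \<Rightarrow> 'w::ordered_euclidean_space"
  assumes S: "\<phi> ` LProb \<rho> = S"
    and map: "\<And>P f. P \<in> LProb \<rho> \<Longrightarrow> \<phi> (map_pmf f P) \<le> \<phi> P"
    and joint: "\<And>(P :: 'u pmf) X Y. P \<in> LProb \<rho> \<Longrightarrow>
      \<phi> (map_pmf (\<lambda>\<omega>. pt_pair (X \<omega>) (Y \<omega>)) P) \<le> \<phi> (map_pmf X P) + \<phi> (map_pmf Y P)"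
    and tensor: "\<And>P Q. \<lbrakk>P \<in> LProb \<rho>; Q \<in> LProb \<rho>\<rbrakk> \<Longrightarrow> \<phi> (LProb_tensor P Q) = \<phi> P + \<phi> Q"
    and unit: "\<phi> LProb_unit = 0"
  shows "entropy (additive_ord_monoid S) \<rho> \<phi>"
proof -
  have "0 \<in> S" using imageI[OF LProb_LProb_unit[of \<rho>], of \<phi>] S by (simp add: unit)
  moreover have "x + y \<in> S" if "x \<in> S" "y \<in> S" for x y
    using that unfolding S[symmetric] 
    by (auto simp flip: tensor intro!: imageI LProb_LProb_tensor)
  ultimately interpret ic_monoid "additive_ord_monoid S" by (rule ic_monoid_additive)
  show ?thesis
    by unfold_locales (use assms in \<open>auto simp: additive_ord_monoid_def\<close>)
qed

lemma map_pt_pair: "map_pmf (\<lambda>\<omega>. pt_pair (X \<omega>) (Y \<omega>)) P = map_pmf (\<lambda>(x, y). pt_pair x y) (map_pmf (\<lambda>\<omega>. (X \<omega>, Y \<omega>)) P)"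
  by (simp add: pmf.map_comp o_def)

lemma inj_on_pt_pair: "inj_on (\<lambda>(x, y). pt_pair x y) A"
  using inj_pt_pair by (rule inj_on_subset) simp

lemma H1_map_pt_pair_le:
  assumes "fin_H1 P"
  shows "H1 (map_pmf (\<lambda>\<omega>. pt_pair (X \<omega>) (Y \<omega>)) P) \<le> H1 (map_pmf X P) + H1 (map_pmf Y P)"
  unfolding map_pt_pair using H1_joint_le[OF assms, of X Y]
  by (simp add: H1_map_inj inj_on_pt_pair fin_H1_map assms)

lemma H1_LProb_tensor: "\<lbrakk>fin_H1 P; fin_H1 Q\<rbrakk> \<Longrightarrow> H1 (LProb_tensor P Q) = H1 P + H1 Q"
  by (simp add: LProb_tensor_def H1_map_inj inj_on_pt_pair fin_H1_pair H1_pair)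

lemma card_set_pmf_pos: "finite (set_pmf P) \<Longrightarrow> 0 < card (set_pmf P)"
  by (simp add: card_gt_0_iff set_pmf_not_empty)

lemma H0_map_le: "finite (set_pmf P) \<Longrightarrow> H0 (map_pmf f P) \<le> H0 P"
  using card_set_pmf_pos[of P] card_set_pmf_pos[of "map_pmf f P"]
  by (simp add: H0_def card_image_le)

lemma H0_map_inj: "inj_on f (set_pmf P) \<Longrightarrow> H0 (map_pmf f P) = H0 P"
  by (simp add: H0_def card_image)

lemma H0_pair: "\<lbrakk>finite (set_pmf P); finite (set_pmf Q)\<rbrakk> \<Longrightarrow> H0 (pair_pmf P Q) = H0 P + H0 Q"
  using card_set_pmf_pos[of P] card_set_pmf_pos[of Q]
  by (simp add: H0_def card_cartesian_product ln_mult_pos del: card_gt_0_iff)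

lemma H0_map_pt_pair_le:
  assumes "finite (set_pmf P)"
  shows "H0 (map_pmf (\<lambda>\<omega>. pt_pair (X \<omega>) (Y \<omega>)) P) \<le> H0 (map_pmf X P) + H0 (map_pmf Y P)"
proof -
  let ?J = "map_pmf (\<lambda>\<omega>. (X \<omega>, Y \<omega>)) P" and ?K = "pair_pmf (map_pmf X P) (map_pmf Y P)"
  have "0 < card (set_pmf ?J)" by (rule card_set_pmf_pos) (simp add: assms)
  moreover have "card (set_pmf ?J) \<le> card (set_pmf ?K)" by (rule card_mono) (use assms in auto)
  ultimately have "H0 ?J \<le> H0 ?K" unfolding H0_def by (intro ln_mono) auto
  then show ?thesis using assms by (simp add: map_pt_pair H0_map_inj inj_on_pt_pair H0_pair)
qed

lemma H0_LProb_tensor: "\<lbrakk>finite (set_pmf P); finite (set_pmf Q)\<rbrakk> \<Longrightarrow> H0 (LProb_tensor P Q) = H0 P + H0 Q"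
  by (simp add: LProb_tensor_def H0_map_inj inj_on_pt_pair H0_pair)

lemma H1_bernoulli: "\<lbrakk>0 < p; p < 1\<rbrakk> \<Longrightarrow> H1 (bernoulli_pmf p) = - (p * ln p + (1 - p) * ln (1 - p))"
  by (simp add: H1_finite UNIV_bool)

text \<open>Binary entropy \<open>h\<close> tends to 0 at 0 and equals \<open>ln 2\<close> at 1/2,
  so it attains \<open>v / real n\<close> in between; \<open>n\<close> independent bits then have
  entropy \<open>v\<close>.\<close>

lemma H1_surj:
  assumes "v \<ge> 0" obtains P :: "'u::points pmf" where "finite (set_pmf P)" "H1 P = v"
proof (cases "v = 0")
  case True
  then show ?thesis using that[of "return_pmf point"] by simp
next
  case False
  define h :: "real \<Rightarrow> real" where "h p = - (p * ln p + (1 - p) * ln (1 - p))" for p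
  \<comment> \<open>Enough bits to bring \<open>v / real n\<close> down to at most
    \<open>ln 2\<close>, the value of \<open>h\<close> at 1/2.\<close>
  define n where "n = nat \<lceil>v / ln 2\<rceil>"
  have vn: "v / ln 2 \<le> real n" "n > 0" using False assms by (auto simp: n_def)
  then have c: "0 < v / real n" "v / real n \<le> ln 2" using False assms by (auto simp: field_simps)
  have "(h \<longlongrightarrow> 0) (at_right 0)" unfolding h_def by real_asymp
  then have "\<forall>\<^sub>F p in at_right 0. h p < v / real n" using c(1) by (rule order_tendstoD)
  then obtain b where b: "b > 0" "\<And>p. 0 < p \<Longrightarrow> p < b \<Longrightarrow> h p < v / real n"
    unfolding eventually_at_right_field by blast
  \<comment> \<open>A positive left end, where \<open>ln\<close> is continuous and
    \<open>h q\<close> is already below the desired value.\<close>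
  define q where "q = min (b / 2) (1 / 2)"
  have q: "0 < q" "q \<le> 1 / 2" "h q < v / real n" using b(1) b(2)[of q] by (auto simp: q_def min_def)
  have "continuous_on {q..1/2} h" unfolding h_def by (intro continuous_intros) (use q in auto)
  moreover have "h (1 / 2) = ln 2" by (simp add: h_def ln_div)
  ultimately obtain p where p: "q \<le> p" "p \<le> 1 / 2" "h p = v / real n"
    using IVT'[of h q "v / real n" "1 / 2"] q c by auto
  let ?B = "replicate_pmf n (bernoulli_pmf p)"
  have fin: "finite (set_pmf ?B)" by (simp add: finite_set_replicate_pmf)
  have "H1 (map_pmf (enc ?B) ?B) = H1 ?B"
    by (intro H1_map_inj inj_on_enc fin_H1_finite fin)
  also have "\<dots> = real n * h p"
    using p q by (simp add: H1_replicate fin_H1_finite H1_bernoulli h_def)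
  also have "\<dots> = v" using p vn by simp
  finally show ?thesis using that[of "map_pmf (enc ?B) ?B"] fin by simp
qed

theorem theorem17:
  fixes \<rho> :: real
  assumes "\<rho> \<ge> 0"
  shows
    "(\<rho> = 0 \<longrightarrow>
       universal_ic_entropy TYPE('v) \<rho> (additive_ord_monoid (H0_H1_FinProb TYPE('u::points)))
         (\<lambda>(P :: 'u pmf) X. (H0 (cod P X), H1 (cod P X))) \<and>
       universal_baseless_ic_entropy TYPE('v) \<rho> (additive_ord_monoid (H0_H1_FinProb TYPE('u)))
         (\<lambda>P :: 'u pmf. (H0 P, H1 P))) \<and>
     (0 < \<rho> \<and> \<rho> < 1 \<longrightarrow>
       universal_ic_entropy TYPE('v) \<rho> (additive_ord_monoid {0::real..})
         (\<lambda>(P :: 'u pmf) X. H1 (cod P X)) \<and>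
       universal_baseless_ic_entropy TYPE('v) \<rho> (additive_ord_monoid {0::real..})
         (\<lambda>P :: 'u pmf. H1 P)) \<and>
     (\<rho> \<ge> 1 \<longrightarrow>
       universal_ic_entropy TYPE('v) \<rho> (additive_ord_monoid {0::real})
         (\<lambda>(P :: 'u pmf) X. 0) \<and>
       universal_baseless_ic_entropy TYPE('v) \<rho> (additive_ord_monoid {0::real})
         (\<lambda>P :: 'u pmf. 0))"
proof (intro conjI[of "_ \<longrightarrow> _"] impI)
  assume \<rho>: "\<rho> = 0"
  let ?S = "H0_H1_FinProb TYPE('u)" and ?\<phi> = "\<lambda>P :: 'u pmf. (H0 P, H1 P)"
  have L: "P \<in> LProb \<rho> \<longleftrightarrow> finite (set_pmf P)" for P :: "'u pmf"
    unfolding \<rho> LProb_0 by (simp add: FinProb_def)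
  have H0_unit: "H0 LProb_unit = 0" by (simp add: H0_def LProb_unit_def)
  have H1_unit: "H1 LProb_unit = 0" by (simp add: LProb_unit_def)
  have S: "?\<phi> ` LProb \<rho> = ?S" by (simp add: \<rho> LProb_0 H0_H1_FinProb_def)
  have "entropy (additive_ord_monoid ?S) \<rho> ?\<phi>"
    by (rule entropy_additiveI[OF S])
       (simp_all add: L H0_map_le H1_map_le H0_map_pt_pair_le H1_map_pt_pair_le H0_LProb_tensor
         H1_LProb_tensor fin_H1_finite H0_unit H1_unit zero_prod_def del: set_map_pmf)
  then show "universal_ic_entropy TYPE('v) \<rho> (additive_ord_monoid ?S) (\<lambda>(P :: 'u pmf) X. (H0 (cod P X), H1 (cod P X))) \<and>
      universal_baseless_ic_entropy TYPE('v) \<rho> (additive_ord_monoid ?S) ?\<phi>"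
  proof (rule universal_entropyI)
    show "carrier (additive_ord_monoid ?S) = ?\<phi> ` LProb \<rho>" by (simp add: additive_ord_monoid_def S)
    fix W' :: "'v ord_monoid" and H :: "'u pmf \<Rightarrow> 'v" and P Q :: "'u pmf"
    assume H: "entropy W' \<rho> H" and P: "P \<in> LProb \<rho>" and Q: "Q \<in> LProb \<rho>"
      and le: "?\<phi> P \<succeq>\<^bsub>additive_ord_monoid ?S\<^esub> ?\<phi> Q"
    interpret entropy W' \<rho> H by fact
    \<comment> \<open>The first component of the product order compares logarithms of support sizes,
      hence the sizes themselves.\<close>
    have "card (set_pmf Q) \<le> card (set_pmf P)"
      using le P Q card_set_pmf_pos[of P] card_set_pmf_pos[of Q]
      by (simp add: additive_ord_monoid_def H0_def L)
    then have "E P \<succeq>\<^bsub>W'\<^esub> E Q"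
      using le P Q by (intro E_ge_finite) (auto simp: L additive_ord_monoid_def)
    then show "H P \<succeq>\<^bsub>W'\<^esub> H Q" using P Q by (simp add: E_eq_H)
  qed
next
  assume \<rho>: "0 < \<rho> \<and> \<rho> < 1"
  have fin: "fin_H1 P" if "P \<in> LProb \<rho>" for P :: "'u pmf" using fin_H1_LProb \<rho> that by blast
  \<comment> \<open>Every nonnegative value is attained on a finite support, and such distributions
    lie in every \<open>LProb \<rho>\<close>.\<close>
  have S: "H1 ` (LProb \<rho> :: 'u pmf set) = {0..}"
  proof (intro equalityI subsetI)
    fix v :: real assume "v \<in> {0..}"
    then obtain P :: "'u pmf" where "finite (set_pmf P)" "H1 P = v" using H1_surj by auto
    then show "v \<in> H1 ` (LProb \<rho> :: 'u pmf set)" using FinProb_imp_LProb by blast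
  qed (auto simp: H1_nonneg fin)
  have "entropy (additive_ord_monoid {0::real..}) \<rho> (H1 :: 'u pmf \<Rightarrow> real)"
    by (rule entropy_additiveI[OF S])
       (auto simp: fin H1_map_le H1_map_pt_pair_le H1_LProb_tensor LProb_unit_def)
  then show "universal_ic_entropy TYPE('v) \<rho> (additive_ord_monoid {0::real..}) (\<lambda>(P :: 'u pmf) X. H1 (cod P X)) \<and>
      universal_baseless_ic_entropy TYPE('v) \<rho> (additive_ord_monoid {0::real..}) (\<lambda>P :: 'u pmf. H1 P)"
  proof (rule universal_entropyI)
    show "carrier (additive_ord_monoid {0::real..}) = H1 ` (LProb \<rho> :: 'u pmf set)"
      by (simp add: additive_ord_monoid_def S)
    fix W' :: "'v ord_monoid" and H :: "'u pmf \<Rightarrow> 'v" and P Q :: "'u pmf"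
    assume H: "entropy W' \<rho> H" and P: "P \<in> LProb \<rho>" and Q: "Q \<in> LProb \<rho>"
      and le: "H1 P \<succeq>\<^bsub>additive_ord_monoid {0::real..}\<^esub> H1 Q"
    interpret entropy W' \<rho> H by fact
    have "E P \<succeq>\<^bsub>W'\<^esub> E Q"
      using le P Q \<rho> by (intro E_ge_lt_1) (auto simp: additive_ord_monoid_def)
    then show "H P \<succeq>\<^bsub>W'\<^esub> H Q" using P Q by (simp add: E_eq_H)
  qed
next
  assume \<rho>: "\<rho> \<ge> 1"
  have S: "(\<lambda>_. 0) ` (LProb \<rho> :: 'u pmf set) = {0::real}" using LProb_LProb_unit by blast
  have "entropy (additive_ord_monoid {0::real}) \<rho> (\<lambda>_ :: 'u pmf. 0)"
    by (rule entropy_additiveI[OF S]) auto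
  then show "universal_ic_entropy TYPE('v) \<rho> (additive_ord_monoid {0::real}) (\<lambda>(P :: 'u pmf) X. 0) \<and>
      universal_baseless_ic_entropy TYPE('v) \<rho> (additive_ord_monoid {0::real}) (\<lambda>P :: 'u pmf. 0)"
  proof (rule universal_entropyI)
    show "carrier (additive_ord_monoid {0::real}) = (\<lambda>_. 0) ` (LProb \<rho> :: 'u pmf set)"
      by (simp add: additive_ord_monoid_def S)
    fix W' :: "'v ord_monoid" and H :: "'u pmf \<Rightarrow> 'v" and P Q :: "'u pmf"
    assume H: "entropy W' \<rho> H" and P: "P \<in> LProb \<rho>" and Q: "Q \<in> LProb \<rho>"
    interpret entropy W' \<rho> H by fact
    have "H P = H Q" using E_eq_one[OF \<rho>, of P] E_eq_one[OF \<rho>, of Q] P Q by (simp add: E_eq_H)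
    then show "H P \<succeq>\<^bsub>W'\<^esub> H Q" using ge_refl[OF H_carrier[OF Q]] by simp
  qed
qed

end
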